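(* Let $\{(G_n,w_n)\}_{n\ge1}$ be a neat family. Then the unique linear transformation $\varphi:\operatorname{Sym}\to\operatorname{Sym}$ mapping $p_\lambda\mapsto X_{(G_\lambda,w_\lambda)}$ for each partition $\lambda$ is exactly the unique linear transformation mapping $X_{(G_\lambda,w_\lambda)}\mapsto p_\lambda$ for each partition $\lambda$. In particular, $\varphi$ is an involutory automorphism of $\operatorname{Sym}$ as a graded algebra.
   Context: $\operatorname{Sym}\subseteq\mathbb{Q}[[x_1,x_2,\dots]]$ is the graded algebra of symmetric functions over $\mathbb{Q}$. The power sum symmetric functions are $p_i=\sum_j x_j^i$ and $p_\lambda=\prod_i p_{\lambda_i}$. A weighted graph $(G,w)$ is a finite graph $G$ with a weight function $w:V(G)\to\mathbb{Z}^+$. A proper colouring is a map $\kappa:V(G)\to\mathbb{Z}^+$ with $\kappa(u)\neq\kappa(v)$ whenever $uv$ is an edge. The extended chromatic symmetric function of $(G,w)$, with vertices $v_1,\dots,v_N$, is $X_{(G,w)}=\sum_\kappa x_{\kappa(v_1)}^{w(v_1)}\cdots x_{\kappa(v_N)}^{w(v_N)}$, summed over all proper colourings $\kappa$ of $G$. A family $\{(G_n,w_n)\}_{n\ge1}$ of simple (no loops, no multiple edges) connected weighted graphs is nifty if the sum of the vertex weights of each $(G_n,w_n)$ is exactly $n$. For a partition $\lambda=(\lambda_1,\dots,\lambda_{\ell(\lambda)})$, $(G_\lambda,w_\lambda)$ is the disjoint union $(G_{\lambda_1},w_{\lambda_1})\cup\cdots\cup(G_{\lambda_{\ell(\lambda)}},w_{\lambda_{\ell(\lambda)}})$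 (for the empty partition, the empty graph, with $X=1$). For a nifty family, $\{X_{(G_\lambda,w_\lambda)}\}_{\lambda\vdash n\ge0}$ is a basis of $\operatorname{Sym}$. A nifty family $\{(G_n,w_n)\}_{n\ge1}$ is neat if for all $n\ge1$ and all subsets $S\subseteq E(G_n)$, the weighted graph $(G_n-S,w_n)$ (obtained by removing the edges in $S$) is isomorphic to $(G_\lambda,w_\lambda)$ for some partition $\lambda\vdash n$. *)

theory Defs
  imports Complex_Main "HOL-Library.Poly_Mapping" "HOL-Library.FuncSet"
begin

text \<open>
  A monomial is an exponent vector of finite support.  The variables are indexed by the type
  \<^typ>\<open>nat\<close>, the index \<open>i\<close> standing for the variable \<open>x_(i+1)\<close> (and, later, for the colour
  \<open>i + 1\<close>).  A formal power series is the function giving its coefficients.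
\<close>

type_synonym mon = "nat \<Rightarrow>\<^sub>0 nat"

definition mdeg :: "mon \<Rightarrow> nat" where
  "mdeg m = (\<Sum>i\<in>Poly_Mapping.keys m. Poly_Mapping.lookup m i)"

text \<open>\<open>Poly_Mapping.map_key \<sigma> m\<close> is the monomial \<open>m\<close> with its variables permuted.\<close>

definition symmetric_series :: "(mon \<Rightarrow> rat) \<Rightarrow> bool" where
  "symmetric_series f \<longleftrightarrow> (\<forall>\<sigma>. bij \<sigma> \<longrightarrow> (\<forall>m. f (Poly_Mapping.map_key \<sigma> m) = f m))"

definition bounded_degree :: "(mon \<Rightarrow> rat) \<Rightarrow> bool" where
  "bounded_degree f \<longleftrightarrow> (\<exists>d. \<forall>m. f m \<noteq> 0 \<longrightarrow> mdeg m \<le> d)"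

definition series_mult :: "(mon \<Rightarrow> rat) \<Rightarrow> (mon \<Rightarrow> rat) \<Rightarrow> mon \<Rightarrow> rat" where
  "series_mult f g m = (\<Sum>(a, b) \<in> {(a, b). a + b = m}. f a * g b)"

lemma mdeg_eq_sum:
  assumes "finite A" "Poly_Mapping.keys m \<subseteq> A"
  shows "mdeg m = (\<Sum>i\<in>A. Poly_Mapping.lookup m i)"
  unfolding mdeg_def using assms
  by (intro sum.mono_neutral_left) (auto simp: in_keys_iff)

lemma mdeg_0 [simp]: "mdeg 0 = 0"
  by (simp add: mdeg_def)

lemma mdeg_add: "mdeg (a + b) = mdeg a + mdeg b"
proof -
  let ?A = "Poly_Mapping.keys a \<union> Poly_Mapping.keys b"
  have "Poly_Mapping.keys (a + b) \<subseteq> ?A"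
    by (rule Poly_Mapping.keys_add)
  then show ?thesis
    by (simp add: mdeg_eq_sum[of ?A] Poly_Mapping.lookup_add sum.distrib)
qed

lemma mdeg_single [simp]: "mdeg (Poly_Mapping.single i k) = k"
  by (cases "k = 0") (auto simp: mdeg_def)

lemma mdeg_sum: "mdeg (\<Sum>x\<in>A. h x) = (\<Sum>x\<in>A. mdeg (h x))"
  by (induction A rule: infinite_finite_induct) (auto simp: mdeg_add)

lemma mdeg_map_key:
  assumes "bij \<sigma>"
  shows "mdeg (Poly_Mapping.map_key \<sigma> m) = mdeg m"
proof -
  have inj: "inj \<sigma>" using assms by (rule bij_is_inj)
  have "bij_betw \<sigma> (\<sigma> -` Poly_Mapping.keys m) (Poly_Mapping.keys m)"
    using assms by (auto simp: bij_betw_def inj_on_def bij_def surj_image_vimage_eq)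
  then show ?thesis
    unfolding mdeg_def keys_map_key[OF inj] Poly_Mapping.map_key.rep_eq[OF inj]
    by (simp add: sum.reindex_bij_betw[where g = "Poly_Mapping.lookup m"] map_key.rep_eq inj)
qed

lemma map_key_sum:
  assumes "inj \<sigma>"
  shows "Poly_Mapping.map_key \<sigma> (\<Sum>x\<in>A. h x) = (\<Sum>x\<in>A. Poly_Mapping.map_key \<sigma> (h x))"
  by (induction A rule: infinite_finite_induct)
    (auto simp: map_key_plus[OF assms] map_key_zero[OF assms])

lemma map_key_inv:
  assumes "bij \<sigma>"
  shows "Poly_Mapping.map_key \<sigma> (Poly_Mapping.map_key (inv \<sigma>) m) = m"
    and "Poly_Mapping.map_key (inv \<sigma>) (Poly_Mapping.map_key \<sigma> m) = m"
proof -
  have i: "inj \<sigma>" "inj (inv \<sigma>)"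
    using assms by (auto simp: bij_is_inj bij_imp_bij_inv)
  have "inv \<sigma> \<circ> \<sigma> = (\<lambda>x. x)" "\<sigma> \<circ> inv \<sigma> = (\<lambda>x. x)"
    using assms by (auto simp: fun_eq_iff bij_is_inj bij_is_surj surj_f_inv_f)
  then show "Poly_Mapping.map_key \<sigma> (Poly_Mapping.map_key (inv \<sigma>) m) = m"
    and "Poly_Mapping.map_key (inv \<sigma>) (Poly_Mapping.map_key \<sigma> m) = m"
    by (simp_all only: map_key_compose i map_key_id)
qed

lemma map_key_single_inv:
  assumes "bij \<sigma>"
  shows "Poly_Mapping.map_key \<sigma> (Poly_Mapping.single i k) = Poly_Mapping.single (inv \<sigma> i) k"
  using map_key_single[OF bij_is_inj[OF assms], of "inv \<sigma> i" k] assms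
  by (simp add: bij_is_surj surj_f_inv_f)

lemma finite_mon_below: "finite {a :: mon. \<forall>i. Poly_Mapping.lookup a i \<le> Poly_Mapping.lookup m i}"
proof -
  let ?K = "Poly_Mapping.keys m"
  let ?S = "{a :: mon. \<forall>i. Poly_Mapping.lookup a i \<le> Poly_Mapping.lookup m i}"
  let ?r = "\<lambda>a :: mon. restrict (Poly_Mapping.lookup a) ?K"
  have "?r ` ?S \<subseteq> (\<Pi>\<^sub>E i\<in>?K. {..Poly_Mapping.lookup m i})"
    by auto
  moreover have "finite (\<Pi>\<^sub>E i\<in>?K. {..Poly_Mapping.lookup m i})"
    by (intro finite_PiE) auto
  ultimately have "finite (?r ` ?S)"
    by (rule finite_subset)
  moreover have "inj_on ?r ?S"
  proof (rule inj_onI)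
    fix a b assume ab: "a \<in> ?S" "b \<in> ?S" "?r a = ?r b"
    show "a = b"
    proof (rule poly_mapping_eqI)
      fix i
      show "Poly_Mapping.lookup a i = Poly_Mapping.lookup b i"
      proof (cases "i \<in> ?K")
        case True
        then show ?thesis using fun_cong[OF ab(3), of i] by simp
      next
        case False
        then have "Poly_Mapping.lookup m i = 0" by (simp add: in_keys_iff)
        then show ?thesis using ab(1,2) by (metis le_zero_eq mem_Collect_eq)
      qed
    qed
  qed
  ultimately show ?thesis by (rule finite_imageD)
qed

lemma finite_mon_splits: "finite {(a, b). a + b = (m :: mon)}"
proof -
  let ?S = "{a :: mon. \<forall>i. Poly_Mapping.lookup a i \<le> Poly_Mapping.lookup m i}"
  have "{(a, b). a + b = m} \<subseteq> ?S \<times> ?S"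
    by (auto simp: Poly_Mapping.lookup_add)
  then show ?thesis
    using finite_mon_below[of m] by (meson finite_SigmaI finite_subset)
qed

lemma series_mult_comm: "series_mult f g = series_mult g f"
proof
  fix m
  show "series_mult f g m = series_mult g f m"
    unfolding series_mult_def
    by (rule sum.reindex_bij_witness[of _ "\<lambda>(a, b). (b, a)" "\<lambda>(a, b). (b, a)"])
      (auto simp: add.commute mult.commute)
qed

lemma series_mult_assoc: "series_mult (series_mult f g) h = series_mult f (series_mult g h)"
proof
  fix m
  let ?D = "\<lambda>m :: mon. {(a, b). a + b = m}"
  have fin: "finite (?D m)" for m by (rule finite_mon_splits)
  have "series_mult (series_mult f g) h m =
      (\<Sum>p\<in>?D m. \<Sum>q\<in>?D (fst p). f (fst q) * g (snd q) * h (snd p))"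
    unfolding series_mult_def
    by (simp add: case_prod_unfold sum_distrib_right)
  also have "\<dots> = (\<Sum>(p, q)\<in>Sigma (?D m) (\<lambda>p. ?D (fst p)). f (fst q) * g (snd q) * h (snd p))"
    by (rule sum.Sigma) (use fin in auto)
  also have "\<dots> = (\<Sum>(p, q)\<in>Sigma (?D m) (\<lambda>p. ?D (snd p)). f (fst p) * g (fst q) * h (snd q))"
    by (rule sum.reindex_bij_witness[of _
          "\<lambda>((a, bc), (b, c)). ((a + b, c), (a, b))" "\<lambda>((ab, c), (a, b)). ((a, b + c), (b, c))"])
      (auto simp: add.assoc)
  also have "\<dots> = (\<Sum>p\<in>?D m. \<Sum>q\<in>?D (snd p). f (fst p) * g (fst q) * h (snd q))"
    by (rule sum.Sigma[symmetric]) (use fin in auto)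
  also have "\<dots> = series_mult f (series_mult g h) m"
    unfolding series_mult_def
    by (simp add: case_prod_unfold sum_distrib_left mult.assoc)
  finally show "series_mult (series_mult f g) h m = series_mult f (series_mult g h) m" .
qed

lemma series_mult_one: "series_mult (\<lambda>m. if m = 0 then 1 else 0) g = g"
proof
  fix m
  have "series_mult (\<lambda>m. if m = 0 then 1 else 0) g m =
      (\<Sum>p\<in>{(a, b). a + b = m}. if p = (0, m) then g m else 0)"
    unfolding series_mult_def by (rule sum.cong) (auto split: if_splits)
  also have "\<dots> = g m"
    using finite_mon_splits[of m] by simp
  finally show "series_mult (\<lambda>m. if m = 0 then 1 else 0) g m = g m" .
qed

lemma series_mult_add_left:
  "series_mult (\<lambda>m. f m + g m) h = (\<lambda>m. series_mult f h m + series_mult g h m)"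
  by (simp add: series_mult_def fun_eq_iff case_prod_unfold distrib_right sum.distrib)

lemma symmetric_series_mult:
  assumes "symmetric_series f" "symmetric_series g"
  shows "symmetric_series (series_mult f g)"
  unfolding symmetric_series_def
proof (intro allI impI)
  fix \<sigma> :: "nat \<Rightarrow> nat" and m
  assume \<sigma>: "bij \<sigma>"
  have inj: "inj \<sigma>" and inj': "inj (inv \<sigma>)"
    using \<sigma> by (auto simp: bij_is_inj bij_imp_bij_inv)
  let ?k = "Poly_Mapping.map_key :: (nat \<Rightarrow> nat) \<Rightarrow> mon \<Rightarrow> mon"
  show "series_mult f g (?k \<sigma> m) = series_mult f g m"
    unfolding series_mult_def
    by (rule sum.reindex_bij_witness[of _
          "\<lambda>(a, b). (?k \<sigma> a, ?k \<sigma> b)" "\<lambda>(a, b). (?k (inv \<sigma>) a, ?k (inv \<sigma>) b)"])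
      (use assms \<sigma> bij_imp_bij_inv[OF \<sigma>] in
        \<open>auto simp: symmetric_series_def map_key_inv map_key_plus[OF inj]
          map_key_plus[OF inj', symmetric]\<close>)
qed

lemma bounded_degree_mult:
  assumes "bounded_degree f" "bounded_degree g"
  shows "bounded_degree (series_mult f g)"
proof -
  obtain d e where d: "\<And>m. f m \<noteq> 0 \<Longrightarrow> mdeg m \<le> d" and e: "\<And>m. g m \<noteq> 0 \<Longrightarrow> mdeg m \<le> e"
    using assms by (auto simp: bounded_degree_def)
  have "mdeg m \<le> d + e" if nz: "series_mult f g m \<noteq> 0" for m
  proof -
    obtain p where "p \<in> {(a, b). a + b = m}" "(case p of (a, b) \<Rightarrow> f a * g b) \<noteq> 0"
      using nz unfolding series_mult_def by (rule sum.not_neutral_contains_not_neutral)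
    then obtain a b where "a + b = m" "f a * g b \<noteq> 0"
      by (cases p) auto
    then show ?thesis
      using d[of a] e[of b] by (auto simp: mdeg_add)
  qed
  then show ?thesis
    by (auto simp: bounded_degree_def)
qed

typedef symfun = "{f :: mon \<Rightarrow> rat. symmetric_series f \<and> bounded_degree f}"
  morphisms coeff Abs_symfun
  by (rule exI[of _ "\<lambda>_. 0"]) (simp add: symmetric_series_def bounded_degree_def)

setup_lifting type_definition_symfun

instantiation symfun :: comm_ring_1
begin

lift_definition zero_symfun :: symfun is "\<lambda>_. 0"
  by (simp add: symmetric_series_def bounded_degree_def)

lift_definition one_symfun :: symfun is "\<lambda>m. if m = 0 then 1 else 0"
proof
  show "symmetric_series (\<lambda>m. if m = 0 then 1 else 0)"
    unfolding symmetric_series_def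
  proof (intro allI impI)
    fix \<sigma> :: "nat \<Rightarrow> nat" and m :: mon
    assume \<sigma>: "bij \<sigma>"
    have "Poly_Mapping.map_key \<sigma> m = 0 \<longleftrightarrow> m = 0"
      using map_key_inv[OF \<sigma>, of m] map_key_zero[OF bij_is_inj[OF \<sigma>]]
        map_key_zero[OF bij_is_inj[OF bij_imp_bij_inv[OF \<sigma>]]] by metis
    then show "(if Poly_Mapping.map_key \<sigma> m = 0 then 1 else 0 :: rat) = (if m = 0 then 1 else 0)"
      by simp
  qed
  show "bounded_degree (\<lambda>m. if m = 0 then 1 else 0)"
    by (auto simp: bounded_degree_def)
qed

lift_definition plus_symfun :: "symfun \<Rightarrow> symfun \<Rightarrow> symfun" is "\<lambda>f g m. f m + g m"
proof
  fix f g :: "mon \<Rightarrow> rat"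
  assume f: "symmetric_series f \<and> bounded_degree f" and g: "symmetric_series g \<and> bounded_degree g"
  show "symmetric_series (\<lambda>m. f m + g m)"
    using f g by (simp add: symmetric_series_def)
  obtain d e where d: "\<And>m. f m \<noteq> 0 \<Longrightarrow> mdeg m \<le> d" and e: "\<And>m. g m \<noteq> 0 \<Longrightarrow> mdeg m \<le> e"
    using f g by (auto simp: bounded_degree_def)
  have "mdeg m \<le> max d e" if "f m + g m \<noteq> 0" for m
    using that d[of m] e[of m] by (cases "f m = 0") auto
  then show "bounded_degree (\<lambda>m. f m + g m)"
    by (auto simp: bounded_degree_def)
qed

lift_definition uminus_symfun :: "symfun \<Rightarrow> symfun" is "\<lambda>f m. - f m"
  by (simp add: symmetric_series_def bounded_degree_def)

definition minus_symfun :: "symfun \<Rightarrow> symfun \<Rightarrow> symfun" where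
  "minus_symfun f g = f + (- g)"

lift_definition times_symfun :: "symfun \<Rightarrow> symfun \<Rightarrow> symfun" is series_mult
  by (simp add: symmetric_series_mult bounded_degree_mult)

instance
proof
  fix a b c :: symfun
  show "a * b * c = a * (b * c)" by transfer (rule series_mult_assoc)
  show "a * b = b * a" by transfer (rule series_mult_comm)
  show "1 * a = a" by transfer (rule series_mult_one)
  show "(a + b) * c = a * c + b * c" by transfer (rule series_mult_add_left)
  show "a + b + c = a + (b + c)" by transfer (simp add: add.assoc)
  show "a + b = b + a" by transfer (simp add: add.commute)
  show "0 + a = a" by transfer simp
  show "- a + a = 0" by transfer simp
  show "a - b = a + - b" by (rule minus_symfun_def)
  show "(0 :: symfun) \<noteq> 1" by transfer (auto simp: fun_eq_iff)
qed

end

lift_definition symfun_scale :: "rat \<Rightarrow> symfun \<Rightarrow> symfun" is "\<lambda>c f m. c * f m"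
  by (auto simp: symmetric_series_def bounded_degree_def)

interpretation symfun: vector_space symfun_scale
  by unfold_locales (transfer; simp add: fun_eq_iff algebra_simps)+

definition homogeneous_part :: "nat \<Rightarrow> symfun set" where
  "homogeneous_part d = {f. \<forall>m. coeff f m \<noteq> 0 \<longrightarrow> mdeg m = d}"

definition graded_algebra_automorphism :: "(symfun \<Rightarrow> symfun) \<Rightarrow> bool" where
  "graded_algebra_automorphism \<phi> \<longleftrightarrow>
     Vector_Spaces.linear symfun_scale symfun_scale \<phi> \<and> bij \<phi> \<and>
     \<phi> 1 = 1 \<and> (\<forall>f g. \<phi> (f * g) = \<phi> f * \<phi> g) \<and>
     (\<forall>d. \<phi> ` homogeneous_part d = homogeneous_part d)"

text \<open>
  The coefficient of \<open>m\<close> in \<open>p_k\<close> is the number of variables \<open>x_j\<close> with \<open>x_j^k = m\<close>.  Only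
  \<open>k \<ge> 1\<close> is meaningful: for \<open>k = 0\<close> the infinite cardinality makes the value 0.
\<close>

lift_definition power_sum :: "nat \<Rightarrow> symfun" is
  "\<lambda>k m. of_nat (card {j. Poly_Mapping.single j k = m})"
proof
  fix k
  show "symmetric_series (\<lambda>m. of_nat (card {j. Poly_Mapping.single j k = m}))"
    unfolding symmetric_series_def
  proof (intro allI impI)
    fix \<sigma> :: "nat \<Rightarrow> nat" and m :: mon
    assume \<sigma>: "bij \<sigma>"
    have eq: "Poly_Mapping.map_key \<sigma> (Poly_Mapping.single j k) = Poly_Mapping.map_key \<sigma> m
        \<longleftrightarrow> Poly_Mapping.single j k = m" for j
      using map_key_inv(2)[OF \<sigma>] by metis
    have "bij_betw (inv \<sigma>) {j. Poly_Mapping.single j k = m}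
        {j. Poly_Mapping.single j k = Poly_Mapping.map_key \<sigma> m}"
      by (rule bij_betw_byWitness[of _ \<sigma>])
        (use \<sigma> in \<open>auto simp: bij_is_inj bij_is_surj surj_f_inv_f eq[symmetric]
           map_key_single[OF bij_is_inj[OF \<sigma>]] map_key_single_inv[OF \<sigma>]\<close>)
    then show "(of_nat (card {j. Poly_Mapping.single j k = Poly_Mapping.map_key \<sigma> m}) :: rat)
        = of_nat (card {j. Poly_Mapping.single j k = m})"
      by (simp add: bij_betw_same_card)
  qed
  have "mdeg m \<le> k" if "(of_nat (card {j. Poly_Mapping.single j k = m}) :: rat) \<noteq> 0" for m
  proof -
    from that have "{j. Poly_Mapping.single j k = m} \<noteq> {}"
      by (metis card.empty of_nat_0)
    then show ?thesis by auto
  qed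
  then show "bounded_degree (\<lambda>m. of_nat (card {j. Poly_Mapping.single j k = m}))"
    unfolding bounded_degree_def by blast
qed

definition is_partition :: "nat list \<Rightarrow> bool" where
  "is_partition l \<longleftrightarrow> sorted_wrt (\<ge>) l \<and> (\<forall>k\<in>set l. k \<ge> 1)"

definition partition_of :: "nat list \<Rightarrow> nat \<Rightarrow> bool" where
  "partition_of l n \<longleftrightarrow> is_partition l \<and> sum_list l = n"

definition power_sum_part :: "nat list \<Rightarrow> symfun" where
  "power_sum_part l = prod_list (map power_sum l)"

text \<open>Edges are the sets of their endpoints; values of the weight off the vertex set are
  irrelevant.\<close>

record 'a wgraph =
  verts :: "'a set"
  edges :: "'a set set"
  weight :: "'a \<Rightarrow> nat"

definition simple_wgraph :: "'a wgraph \<Rightarrow> bool" where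
  "simple_wgraph G \<longleftrightarrow> finite (verts G) \<and>
     edges G \<subseteq> {{u, v} |u v. u \<in> verts G \<and> v \<in> verts G \<and> u \<noteq> v} \<and>
     (\<forall>v\<in>verts G. weight G v \<ge> 1)"

definition adjacency :: "'a wgraph \<Rightarrow> ('a \<times> 'a) set" where
  "adjacency G = {(u, v). {u, v} \<in> edges G}"

definition connected_wgraph :: "'a wgraph \<Rightarrow> bool" where
  "connected_wgraph G \<longleftrightarrow> verts G \<noteq> {} \<and> (\<forall>u\<in>verts G. \<forall>v\<in>verts G. (u, v) \<in> (adjacency G)\<^sup>*)"

definition total_weight :: "'a wgraph \<Rightarrow> nat" where
  "total_weight G = (\<Sum>v\<in>verts G. weight G v)"

definition delete_edges :: "'a wgraph \<Rightarrow> 'a set set \<Rightarrow> 'a wgraph" where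
  "delete_edges G S = G\<lparr>edges := edges G - S\<rparr>"

definition wgraph_iso :: "'a wgraph \<Rightarrow> 'b wgraph \<Rightarrow> bool" where
  "wgraph_iso G H \<longleftrightarrow> (\<exists>f. bij_betw f (verts G) (verts H) \<and>
     (\<forall>u\<in>verts G. \<forall>v\<in>verts G. {u, v} \<in> edges G \<longleftrightarrow> {f u, f v} \<in> edges H) \<and>
     (\<forall>v\<in>verts G. weight H (f v) = weight G v))"

text \<open>The vertices of a disjoint union are tagged with the position of their component.\<close>

definition disjoint_union :: "'a wgraph list \<Rightarrow> (nat \<times> 'a) wgraph" where
  "disjoint_union Gs =
     \<lparr>verts = {(i, v). i < length Gs \<and> v \<in> verts (Gs ! i)},
      edges = {Pair i ` e |i e. i < length Gs \<and> e \<in> edges (Gs ! i)},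
      weight = (\<lambda>(i, v). weight (Gs ! i) v)\<rparr>"

text \<open>Colourings are taken to be extensional, so that they are determined by the vertex set.\<close>

definition proper_colourings :: "'a wgraph \<Rightarrow> ('a \<Rightarrow> nat) set" where
  "proper_colourings G =
     {\<kappa> \<in> verts G \<rightarrow>\<^sub>E UNIV.
       \<forall>u\<in>verts G. \<forall>v\<in>verts G. {u, v} \<in> edges G \<longrightarrow> \<kappa> u \<noteq> \<kappa> v}"

definition colouring_monomial :: "'a wgraph \<Rightarrow> ('a \<Rightarrow> nat) \<Rightarrow> mon" where
  "colouring_monomial G \<kappa> = (\<Sum>v\<in>verts G. Poly_Mapping.single (\<kappa> v) (weight G v))"

lemma mdeg_colouring_monomial: "mdeg (colouring_monomial G \<kappa>) = total_weight G"
  by (simp add: colouring_monomial_def total_weight_def mdeg_sum)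

lemma colouring_monomial_permute:
  assumes "bij \<sigma>"
  shows "colouring_monomial G (restrict (\<lambda>v. inv \<sigma> (\<kappa> v)) (verts G)) =
    Poly_Mapping.map_key \<sigma> (colouring_monomial G \<kappa>)"
  unfolding colouring_monomial_def map_key_sum[OF bij_is_inj[OF assms]]
  by (intro sum.cong) (auto simp: map_key_single_inv[OF assms])

lemma permute_proper_colouring:
  assumes "bij \<sigma>" "\<kappa> \<in> proper_colourings G"
  shows "restrict (\<lambda>v. \<sigma> (\<kappa> v)) (verts G) \<in> proper_colourings G"
  using assms unfolding proper_colourings_def by (auto dest!: bij_is_inj simp: inj_eq)

text \<open>
  The extended chromatic symmetric function: as a formal sum of monomials, its coefficient at
  \<open>m\<close> is the number of proper colourings whose monomial is \<open>m\<close> (a finite number as soon as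
  the graph is finite and has positive weights).
\<close>

lift_definition chromatic :: "'a wgraph \<Rightarrow> symfun" is
  "\<lambda>G m. of_nat (card {\<kappa> \<in> proper_colourings G. colouring_monomial G \<kappa> = m})"
proof
  fix G :: "'a wgraph"
  let ?C = "\<lambda>m. {\<kappa> \<in> proper_colourings G. colouring_monomial G \<kappa> = m}"
  let ?k = "Poly_Mapping.map_key :: (nat \<Rightarrow> nat) \<Rightarrow> mon \<Rightarrow> mon"
  let ?r = "\<lambda>\<sigma> \<kappa>. restrict (\<lambda>v. \<sigma> (\<kappa> v)) (verts G)"
  show "symmetric_series (\<lambda>m. of_nat (card (?C m)))"
    unfolding symmetric_series_def
  proof (intro allI impI)
    fix \<sigma> :: "nat \<Rightarrow> nat" and m :: mon
    assume \<sigma>: "bij \<sigma>"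
    have \<sigma>': "bij (inv \<sigma>)" using \<sigma> by (rule bij_imp_bij_inv)
    have inv_inv: "inv (inv \<sigma>) = \<sigma>" using \<sigma> by (rule inv_inv_eq)
    have ext: "\<kappa> \<in> extensional (verts G)" if "\<kappa> \<in> ?C n" for \<kappa> n
      using that by (auto simp: proper_colourings_def PiE_def)
    have "bij_betw (?r (inv \<sigma>)) (?C m) (?C (?k \<sigma> m))"
    proof (rule bij_betw_byWitness[of _ "?r \<sigma>"])
      show "\<forall>\<kappa>\<in>?C m. ?r \<sigma> (?r (inv \<sigma>) \<kappa>) = \<kappa>"
        using \<sigma> ext by (auto intro!: extensionalityI[of _ "verts G"]
          simp: bij_is_surj surj_f_inv_f)
      show "\<forall>\<kappa>\<in>?C (?k \<sigma> m). ?r (inv \<sigma>) (?r \<sigma> \<kappa>) = \<kappa>"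
        using \<sigma> ext by (auto intro!: extensionalityI[of _ "verts G"] simp: bij_is_inj)
      show "?r (inv \<sigma>) ` ?C m \<subseteq> ?C (?k \<sigma> m)"
        using colouring_monomial_permute[OF \<sigma>, of G] permute_proper_colouring[OF \<sigma>', of _ G]
        by auto
      show "?r \<sigma> ` ?C (?k \<sigma> m) \<subseteq> ?C m"
        using colouring_monomial_permute[OF \<sigma>', of G, unfolded inv_inv]
          permute_proper_colouring[OF \<sigma>, of _ G] map_key_inv(2)[OF \<sigma>, of m]
        by auto
    qed
    then show "(of_nat (card (?C (?k \<sigma> m))) :: rat) = of_nat (card (?C m))"
      by (simp add: bij_betw_same_card)
  qed
  have "mdeg m \<le> total_weight G" if "(of_nat (card (?C m)) :: rat) \<noteq> 0" for m
  proof -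
    from that have "?C m \<noteq> {}"
      by (metis card.empty of_nat_0)
    then show ?thesis by (auto simp: mdeg_colouring_monomial)
  qed
  then show "bounded_degree (\<lambda>m. of_nat (card (?C m)))"
    unfolding bounded_degree_def by blast
qed

text \<open>A family \<open>(G_n, w_n)\<close>, \<open>n \<ge> 1\<close>, is a function on \<^typ>\<open>nat\<close> whose value at 0 is ignored.\<close>

definition nifty :: "(nat \<Rightarrow> 'a wgraph) \<Rightarrow> bool" where
  "nifty G \<longleftrightarrow> (\<forall>n\<ge>1. simple_wgraph (G n) \<and> connected_wgraph (G n) \<and> total_weight (G n) = n)"

definition family_part :: "(nat \<Rightarrow> 'a wgraph) \<Rightarrow> nat list \<Rightarrow> (nat \<times> 'a) wgraph" where
  "family_part G l = disjoint_union (map G l)"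

definition neat :: "(nat \<Rightarrow> 'a wgraph) \<Rightarrow> bool" where
  "neat G \<longleftrightarrow> nifty G \<and>
     (\<forall>n\<ge>1. \<forall>S. S \<subseteq> edges (G n) \<longrightarrow>
        (\<exists>l. partition_of l n \<and> wgraph_iso (delete_edges (G n) S) (family_part G l)))"

end

theory Submission
  imports Defs "HOL-Combinatorics.Permutations"
begin

text \<open>
  For a graph \<open>H\<close> let \<open>M_H\<close> be the generating series of the colourings that are constant along
  every edge.  Expanding \<open>[\<kappa> proper] = \<Prod>_e (1 - [\<kappa> constant on e])\<close> gives
  \<open>X_H = \<Sum>_S (-1)^|S| M_(H|S)\<close>, where \<open>S\<close> runs over the sets of edges and \<open>H|S\<close> keeps just the
  edges in \<open>S\<close>; exchanging the two kinds of edges gives \<open>M_H = \<Sum>_S (-1)^|S| X_(H|S)\<close>.  Since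
  \<open>G_n\<close> is connected of weight \<open>n\<close>, \<open>M_(G_n) = p_n\<close>, and hence \<open>M_(G_l) = p_l\<close>.  In a neat family
  every \<open>G_n|S\<close> is some \<open>G_l\<close>, so \<open>X_(G_n)\<close> is expressed by the \<open>p_l\<close> exactly as \<open>p_n\<close> is by the
  \<open>X_(G_l)\<close>, and \<open>\<phi>\<close> maps \<open>X_(G_n)\<close> to \<open>p_n\<close>.  As \<open>\<phi>\<close> is multiplicative and the \<open>p_l\<close> form a basis,
  \<open>\<phi>\<close> is an involution.
\<close>

section \<open>Colourings with a condition on edges\<close>

text \<open>\<open>R\<close> is \<open>(\<noteq>)\<close> for the series \<open>X_H\<close> and
  \<open>(=)\<close> for \<open>M_H\<close>; leaving it a parameter lets isomorphisms, unions and
  inclusion-exclusion be treated once for both.\<close>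

definition edge_colourings :: "(nat \<Rightarrow> nat \<Rightarrow> bool) \<Rightarrow> 'a wgraph \<Rightarrow> mon \<Rightarrow> ('a \<Rightarrow> nat) set" where
  "edge_colourings R G m =
     {\<kappa> \<in> verts G \<rightarrow>\<^sub>E UNIV.
       (\<forall>u\<in>verts G. \<forall>v\<in>verts G. {u, v} \<in> edges G \<longrightarrow> R (\<kappa> u) (\<kappa> v)) \<and>
       colouring_monomial G \<kappa> = m}"

definition colour_series :: "(nat \<Rightarrow> nat \<Rightarrow> bool) \<Rightarrow> 'a wgraph \<Rightarrow> mon \<Rightarrow> rat" where
  "colour_series R G m = of_nat (card (edge_colourings R G m))"

lemma coeff_chromatic: "coeff (chromatic G) = colour_series (\<noteq>) G"
  by (auto simp: fun_eq_iff chromatic.rep_eq colour_series_def edge_colourings_def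
      proper_colourings_def intro!: arg_cong[where f = card])

text \<open>Every colour used occurs in the monomial because weights are positive, so only the
  finitely many variables of \<open>m\<close> are available as colours.\<close>

lemma finite_edge_colourings:
  assumes "finite (verts G)" "\<forall>v\<in>verts G. weight G v \<ge> 1"
  shows "finite (edge_colourings R G m)"
proof (rule finite_subset)
  show "edge_colourings R G m \<subseteq> verts G \<rightarrow>\<^sub>E Poly_Mapping.keys m"
  proof
    fix \<kappa> assume \<kappa>: "\<kappa> \<in> edge_colourings R G m"
    have "\<kappa> v \<in> Poly_Mapping.keys m" if v: "v \<in> verts G" for v
    proof -
      have "Poly_Mapping.lookup m (\<kappa> v) = (\<Sum>u\<in>verts G. Poly_Mapping.lookup (Poly_Mapping.single (\<kappa> u) (weight G u)) (\<kappa> v))"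
        using \<kappa> by (auto simp: edge_colourings_def colouring_monomial_def Poly_Mapping.lookup_sum)
      also have "\<dots> \<ge> Poly_Mapping.lookup (Poly_Mapping.single (\<kappa> v) (weight G v)) (\<kappa> v)"
        using v assms(1) by (intro member_le_sum) auto
      finally show ?thesis using assms(2) v by (auto simp: in_keys_iff)
    qed
    then show "\<kappa> \<in> verts G \<rightarrow>\<^sub>E Poly_Mapping.keys m"
      using \<kappa> by (auto simp: edge_colourings_def)
  qed
  show "finite (verts G \<rightarrow>\<^sub>E Poly_Mapping.keys m)"
    using assms(1) by (simp add: finite_PiE)
qed

lemma colour_series_iso:
  assumes "wgraph_iso G H"
  shows "colour_series R G = colour_series R H"
proof
  fix m
  obtain f where f: "bij_betw f (verts G) (verts H)"
    and e: "\<And>u v. u \<in> verts G \<Longrightarrow> v \<in> verts G \<Longrightarrow> {u, v} \<in> edges G \<longleftrightarrow> {f u, f v} \<in> edges H"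
    and w: "\<And>v. v \<in> verts G \<Longrightarrow> weight H (f v) = weight G v"
    using assms by (auto simp: wgraph_iso_def)
  let ?g = "inv_into (verts G) f"
  have g: "?g u \<in> verts G" "f (?g u) = u" if "u \<in> verts H" for u
    using that f by (auto simp: bij_betw_def f_inv_into_f inv_into_into)
  have gf: "?g (f v) = v" "f v \<in> verts H" if "v \<in> verts G" for v
    using that f by (auto simp: bij_betw_def)
  have mono: "colouring_monomial G \<kappa> = colouring_monomial H \<kappa>'"
    if "\<And>v. v \<in> verts G \<Longrightarrow> \<kappa>' (f v) = \<kappa> v" for \<kappa> \<kappa>'
    unfolding colouring_monomial_def sum.reindex_bij_betw[OF f, symmetric]
    by (rule sum.cong) (auto simp: that w)
  have "bij_betw (\<lambda>\<kappa>. restrict (\<kappa> \<circ> f) (verts G)) (edge_colourings R H m) (edge_colourings R G m)"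
  proof (rule bij_betw_byWitness[where f' = "\<lambda>\<kappa>. restrict (\<kappa> \<circ> ?g) (verts H)"])
    show "\<forall>\<kappa>\<in>edge_colourings R H m.
        restrict (restrict (\<kappa> \<circ> f) (verts G) \<circ> ?g) (verts H) = \<kappa>"
      by (auto simp: edge_colourings_def fun_eq_iff g PiE_def extensional_def)
    show "\<forall>\<kappa>\<in>edge_colourings R G m.
        restrict (restrict (\<kappa> \<circ> ?g) (verts H) \<circ> f) (verts G) = \<kappa>"
      by (auto simp: edge_colourings_def fun_eq_iff gf PiE_def extensional_def)
    show "(\<lambda>\<kappa>. restrict (\<kappa> \<circ> f) (verts G)) ` edge_colourings R H m \<subseteq> edge_colourings R G m"
    proof clarify
      fix \<kappa> assume "\<kappa> \<in> edge_colourings R H m"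
      then show "restrict (\<kappa> \<circ> f) (verts G) \<in> edge_colourings R G m"
        using mono[of \<kappa> "restrict (\<kappa> \<circ> f) (verts G)"] by (auto simp: edge_colourings_def e gf)
    qed
    show "(\<lambda>\<kappa>. restrict (\<kappa> \<circ> ?g) (verts H)) ` edge_colourings R G m \<subseteq> edge_colourings R H m"
    proof clarify
      fix \<kappa> assume \<kappa>: "\<kappa> \<in> edge_colourings R G m"
      have "R (\<kappa> (?g u)) (\<kappa> (?g v))" if "u \<in> verts H" "v \<in> verts H" "{u, v} \<in> edges H" for u v
        using \<kappa> that e[of "?g u" "?g v"] by (auto simp: edge_colourings_def g)
      then show "restrict (\<kappa> \<circ> ?g) (verts H) \<in> edge_colourings R H m"
        using \<kappa> mono[of "restrict (\<kappa> \<circ> ?g) (verts H)" \<kappa>] by (auto simp: edge_colourings_def gf)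
    qed
  qed
  then show "colour_series R G m = colour_series R H m"
    by (simp add: colour_series_def bij_betw_same_card)
qed

section \<open>Disjoint unions, inclusion-exclusion over edges, connected graphs\<close>

lemma verts_disjoint_union_Cons:
  "verts (disjoint_union (G # Gs)) =
     Pair 0 ` verts G \<union> (\<lambda>(i, v). (Suc i, v)) ` verts (disjoint_union Gs)"
  by (auto simp: disjoint_union_def image_iff nth_Cons split: nat.splits)

lemma edges_disjoint_union:
  "{(i, u), (j, v)} \<in> edges (disjoint_union Gs) \<longleftrightarrow>
     i = j \<and> i < length Gs \<and> {u, v} \<in> edges (Gs ! i)"
proof
  assume "{(i, u), (j, v)} \<in> edges (disjoint_union Gs)"
  then obtain k e where k: "k < length Gs" "e \<in> edges (Gs ! k)"
    and eq: "{(i, u), (j, v)} = Pair k ` e"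
    by (auto simp: disjoint_union_def)
  have "i = k" "j = k" using eq by blast+
  moreover have "e = {u, v}"
    using eq \<open>i = k\<close> \<open>j = k\<close> inj_image_eq_iff[of "Pair k" e "{u, v}"]
    by (simp add: inj_on_def)
  ultimately show "i = j \<and> i < length Gs \<and> {u, v} \<in> edges (Gs ! i)" using k by simp
next
  assume "i = j \<and> i < length Gs \<and> {u, v} \<in> edges (Gs ! i)"
  then show "{(i, u), (j, v)} \<in> edges (disjoint_union Gs)"
    by (auto simp: disjoint_union_def intro!: exI[of _ i] exI[of _ "{u, v}"])
qed

lemma weight_disjoint_union: "weight (disjoint_union Gs) p = weight (Gs ! fst p) (snd p)"
  by (simp add: disjoint_union_def case_prod_unfold)

lemma finite_verts_disjoint_union:
  assumes "\<forall>G\<in>set Gs. finite (verts G)"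
  shows "finite (verts (disjoint_union Gs))"
proof -
  have "verts (disjoint_union Gs) = (SIGMA i:{..<length Gs}. verts (Gs ! i))"
    by (auto simp: disjoint_union_def)
  then show ?thesis using assms by (auto intro!: finite_SigmaI)
qed

text \<open>The empty graph has exactly one extensional colouring,
  \<open>\<lambda>_. undefined\<close>, and its monomial is the empty sum, the zero exponent
  vector.\<close>

lemma colour_series_disjoint_union_Nil:
  "colour_series R (disjoint_union ([] :: 'a wgraph list)) = (\<lambda>m. if m = 0 then 1 else 0)"
proof
  fix m
  have "edge_colourings R (disjoint_union ([] :: 'a wgraph list)) m = (if m = 0 then {\<lambda>_. undefined} else {})"
    by (auto simp: edge_colourings_def disjoint_union_def colouring_monomial_def)
  then show "colour_series R (disjoint_union ([] :: 'a wgraph list)) m = (if m = 0 then 1 else 0)"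
    by (simp add: colour_series_def)
qed

lemma colouring_monomial_disjoint_union_Cons:
  assumes "\<forall>H\<in>set (G # Gs). finite (verts H)"
  shows "colouring_monomial (disjoint_union (G # Gs)) \<kappa> =
    colouring_monomial G (\<lambda>v. \<kappa> (0, v)) +
    colouring_monomial (disjoint_union Gs) (\<lambda>(i, v). \<kappa> (Suc i, v))"
proof -
  have "finite (verts G)" "finite (verts (disjoint_union Gs))"
    using assms finite_verts_disjoint_union by auto
  moreover have "inj_on (\<lambda>(i, v). (Suc i, v)) (verts (disjoint_union Gs))"
    by (auto simp: inj_on_def)
  ultimately show ?thesis
    unfolding colouring_monomial_def verts_disjoint_union_Cons
    by (subst sum.union_disjoint)
      (auto simp: sum.reindex inj_on_def weight_disjoint_union case_prod_unfold)
qed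

lemma colouring_monomial_cong:
  "(\<And>v. v \<in> verts G \<Longrightarrow> \<kappa> v = \<kappa>' v) \<Longrightarrow> colouring_monomial G \<kappa> = colouring_monomial G \<kappa>'"
  by (simp add: colouring_monomial_def)

text \<open>No edge joins \<open>G\<close> to the other components, so a colouring of the union is
  an independent pair of colourings. Exponent vectors add, which makes the counts convolve as in
  \<open>series_mult\<close>.\<close>

lemma colour_series_disjoint_union_Cons:
  assumes fin: "\<forall>H\<in>set (G # Gs). finite (verts H)"
    and pos: "\<forall>H\<in>set (G # Gs). \<forall>v\<in>verts H. weight H v \<ge> 1"
  shows "colour_series R (disjoint_union (G # Gs)) =
    series_mult (colour_series R G) (colour_series R (disjoint_union Gs))"
proof
  fix m :: mon
  define U U' where "U = disjoint_union Gs" and "U' = disjoint_union (G # Gs)"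
  define hd_part where "hd_part = (\<lambda>\<kappa> :: nat \<times> 'a \<Rightarrow> nat. restrict (\<lambda>v. \<kappa> (0, v)) (verts G))"
  define tl_part where "tl_part = (\<lambda>\<kappa> :: nat \<times> 'a \<Rightarrow> nat. restrict (\<lambda>(i, v). \<kappa> (Suc i, v)) (verts U))"
  define join :: "('a \<Rightarrow> nat) \<times> (nat \<times> 'a \<Rightarrow> nat) \<Rightarrow> nat \<times> 'a \<Rightarrow> nat"
    where "join = (\<lambda>(\<kappa>, \<kappa>'). restrict (\<lambda>(i, v). case i of 0 \<Rightarrow> \<kappa> v | Suc j \<Rightarrow> \<kappa>' (j, v)) (verts U'))"
  let ?D = "{(a, b). a + b = m}"
  let ?A = "\<lambda>p. edge_colourings R G (fst p) \<times> edge_colourings R U (snd p)"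
  let ?mon = "\<lambda>\<kappa>. (colouring_monomial G (hd_part \<kappa>), colouring_monomial U (tl_part \<kappa>))"
  have V: "(0, v) \<in> verts U' \<longleftrightarrow> v \<in> verts G" "(Suc i, v) \<in> verts U' \<longleftrightarrow> (i, v) \<in> verts U" for i v
    by (auto simp: U_def U'_def verts_disjoint_union_Cons)
  have E: "{(0, u), (0, v)} \<in> edges U' \<longleftrightarrow> {u, v} \<in> edges G"
    "{(Suc i, u), (Suc j, v)} \<in> edges U' \<longleftrightarrow> {(i, u), (j, v)} \<in> edges U"
    "{(0, u), (Suc j, v)} \<notin> edges U'" "{(Suc j, u), (0, v)} \<notin> edges U'" for i j u v
    by (simp_all add: U_def U'_def edges_disjoint_union)
  have mon: "colouring_monomial U' \<kappa> = colouring_monomial G (hd_part \<kappa>) + colouring_monomial U (tl_part \<kappa>)" for \<kappa>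
    unfolding U'_def colouring_monomial_disjoint_union_Cons[OF fin] U_def[symmetric]
    by (intro arg_cong2[where f = "(+)"] colouring_monomial_cong) (auto simp: hd_part_def tl_part_def)
  have join_split: "join (hd_part \<kappa>, tl_part \<kappa>) = \<kappa>" if "\<kappa> \<in> extensional (verts U')" for \<kappa>
  proof (rule extensionalityI[OF _ that])
    fix p assume "p \<in> verts U'"
    then show "join (hd_part \<kappa>, tl_part \<kappa>) p = \<kappa> p"
      by (cases p; cases "fst p") (simp_all add: join_def hd_part_def tl_part_def V)
  qed (simp add: join_def)
  have split_join: "hd_part (join (\<kappa>, \<kappa>')) = \<kappa>" "tl_part (join (\<kappa>, \<kappa>')) = \<kappa>'"
    if "\<kappa> \<in> extensional (verts G)" "\<kappa>' \<in> extensional (verts U)" for \<kappa> \<kappa>'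
  proof -
    show "hd_part (join (\<kappa>, \<kappa>')) = \<kappa>"
      by (rule extensionalityI[OF _ that(1)]) (simp_all add: join_def hd_part_def V)
    show "tl_part (join (\<kappa>, \<kappa>')) = \<kappa>'"
      by (rule extensionalityI[OF _ that(2)]) (auto simp: join_def tl_part_def V)
  qed
  \<comment> \<open>Recording the two monomials along with the two restrictions makes the target a
    \<open>Sigma\<close> over the splittings \<open>a + b = m\<close>, the index set of
    \<open>series_mult\<close>.\<close>
  have "bij_betw (\<lambda>\<kappa>. (?mon \<kappa>, (hd_part \<kappa>, tl_part \<kappa>))) (edge_colourings R U' m) (Sigma ?D ?A)"
  proof (rule bij_betw_byWitness[where f' = "\<lambda>p. join (snd p)"])
    show "\<forall>\<kappa>\<in>edge_colourings R U' m. join (snd (?mon \<kappa>, (hd_part \<kappa>, tl_part \<kappa>))) = \<kappa>"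
      using join_split by (simp add: edge_colourings_def PiE_def)
    show "\<forall>x\<in>Sigma ?D ?A. (?mon (join (snd x)), (hd_part (join (snd x)), tl_part (join (snd x)))) = x"
    proof
      fix x assume x: "x \<in> Sigma ?D ?A"
      obtain a b \<kappa> \<kappa>' where x_eq: "x = ((a, b), (\<kappa>, \<kappa>'))" by (metis prod.collapse)
      have "\<kappa> \<in> edge_colourings R G a" "\<kappa>' \<in> edge_colourings R U b"
        using x unfolding x_eq by simp_all
      then show "(?mon (join (snd x)), (hd_part (join (snd x)), tl_part (join (snd x)))) = x"
        unfolding x_eq by (simp add: edge_colourings_def PiE_def split_join)
    qed
    show "(\<lambda>\<kappa>. (?mon \<kappa>, (hd_part \<kappa>, tl_part \<kappa>))) ` edge_colourings R U' m \<subseteq> Sigma ?D ?A"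
    proof (rule image_subsetI)
      fix \<kappa> assume \<kappa>: "\<kappa> \<in> edge_colourings R U' m"
      have R: "R (\<kappa> u) (\<kappa> v)" if "u \<in> verts U'" "v \<in> verts U'" "{u, v} \<in> edges U'" for u v
        using \<kappa> that by (simp add: edge_colourings_def)
      have "hd_part \<kappa> \<in> edge_colourings R G (colouring_monomial G (hd_part \<kappa>))"
        by (auto simp: edge_colourings_def hd_part_def V E intro!: R)
      moreover have "tl_part \<kappa> \<in> edge_colourings R U (colouring_monomial U (tl_part \<kappa>))"
        by (auto simp: edge_colourings_def tl_part_def V E intro!: R)
      moreover have "colouring_monomial G (hd_part \<kappa>) + colouring_monomial U (tl_part \<kappa>) = m"
        using \<kappa> mon[of \<kappa>] by (simp add: edge_colourings_def)
      ultimately show "(?mon \<kappa>, (hd_part \<kappa>, tl_part \<kappa>)) \<in> Sigma ?D ?A" by simp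
    qed
    show "(\<lambda>p. join (snd p)) ` Sigma ?D ?A \<subseteq> edge_colourings R U' m"
    proof (rule image_subsetI)
      fix x assume x: "x \<in> Sigma ?D ?A"
      obtain a b \<kappa> \<kappa>' where x_eq: "x = ((a, b), (\<kappa>, \<kappa>'))" by (metis prod.collapse)
      have m: "m = a + b" and \<kappa>: "\<kappa> \<in> edge_colourings R G a" and \<kappa>': "\<kappa>' \<in> edge_colourings R U b"
        using x unfolding x_eq by auto
      have "colouring_monomial U' (join (\<kappa>, \<kappa>')) = m"
        using \<kappa> \<kappa>' unfolding mon m by (simp add: edge_colourings_def PiE_def split_join)
      moreover have "R (join (\<kappa>, \<kappa>') p) (join (\<kappa>, \<kappa>') q)"
        if "p \<in> verts U'" "q \<in> verts U'" "{p, q} \<in> edges U'" for p q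
        using that \<kappa> \<kappa>'
        by (cases p; cases q; cases "fst p"; cases "fst q")
          (simp_all add: join_def edge_colourings_def V E)
      ultimately show "join (snd x) \<in> edge_colourings R U' m"
        unfolding x_eq by (simp add: edge_colourings_def PiE_def) (simp add: join_def)
    qed
  qed
  then have "card (edge_colourings R U' m) = card (Sigma ?D ?A)"
    by (rule bij_betw_same_card)
  also have "\<dots> = (\<Sum>p\<in>?D. card (?A p))"
  proof (rule card_SigmaI)
    have "\<forall>v\<in>verts U. weight U v \<ge> 1"
      using pos by (auto simp: U_def disjoint_union_def)
    moreover have "finite (verts U)"
      unfolding U_def using fin by (intro finite_verts_disjoint_union) simp
    ultimately show "\<forall>p\<in>?D. finite (?A p)"
      using fin pos by (simp add: finite_edge_colourings)
  qed (rule finite_mon_splits)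
  finally show "colour_series R (disjoint_union (G # Gs)) m =
      series_mult (colour_series R G) (colour_series R (disjoint_union Gs)) m"
    by (simp add: colour_series_def series_mult_def card_cartesian_product case_prod_unfold U_def U'_def)
qed

text \<open>For each colouring, the product over all edges of 1 minus the indicator that
  \<open>R\<close> holds on the edge is the indicator that \<open>R\<close> fails on every edge.
  Expanding it over the subsets \<open>S\<close> and summing over the colourings with monomial
  \<open>m\<close> gives the claim. Used with \<open>R\<close> equal to \<open>(=)\<close> and to
  \<open>(\<noteq>)\<close>.\<close>

lemma colour_series_inclusion_exclusion:
  assumes "simple_wgraph G" and sym: "\<And>a b. R a b \<Longrightarrow> R b a"
  shows "colour_series (\<lambda>a b. \<not> R a b) G m =
    (\<Sum>S\<in>Pow (edges G). (- 1) ^ card S * colour_series R (G\<lparr>edges := S\<rparr>) m)"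
proof -
  let ?E = "edges G" and ?V = "verts G"
  let ?K = "edge_colourings (\<lambda>_ _. True) G m"
  let ?P = "\<lambda>\<kappa> e. \<forall>u\<in>?V. \<forall>v\<in>?V. e = {u, v} \<longrightarrow> R (\<kappa> u) (\<kappa> v)"
  have finV: "finite ?V" and E: "?E \<subseteq> {{u, v} |u v. u \<in> ?V \<and> v \<in> ?V \<and> u \<noteq> v}"
    and pos: "\<forall>v\<in>?V. weight G v \<ge> 1"
    using assms(1) by (auto simp: simple_wgraph_def)
  have finE: "finite ?E"
    using E finV by (intro finite_subset[of ?E "Pow ?V"]) auto
  have finK: "finite ?K"
    using finV pos by (rule finite_edge_colourings)
  \<comment> \<open>The quantifiers see the endpoints of an edge in both orders. By symmetry of
    \<open>R\<close> both impose the same condition, so negation passes through the universal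
    quantifiers.\<close>
  have neg: "(\<not> ?P \<kappa> e) = (\<forall>u\<in>?V. \<forall>v\<in>?V. e = {u, v} \<longrightarrow> \<not> R (\<kappa> u) (\<kappa> v))" if "e \<in> ?E" for e \<kappa>
  proof -
    obtain u v where uv: "u \<in> ?V" "v \<in> ?V" "e = {u, v}" using E \<open>e \<in> ?E\<close> by blast
    have "?P \<kappa> e \<longleftrightarrow> R (\<kappa> u) (\<kappa> v)"
      using uv sym[of "\<kappa> u" "\<kappa> v"] sym[of "\<kappa> v" "\<kappa> u"] by (auto simp: doubleton_eq_iff)
    moreover have "(\<forall>u\<in>?V. \<forall>v\<in>?V. e = {u, v} \<longrightarrow> \<not> R (\<kappa> u) (\<kappa> v)) \<longleftrightarrow> \<not> R (\<kappa> u) (\<kappa> v)"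
      using uv sym[of "\<kappa> u" "\<kappa> v"] sym[of "\<kappa> v" "\<kappa> u"] by (auto simp: doubleton_eq_iff)
    ultimately show ?thesis by simp
  qed
  have card_eq: "of_nat (card {\<kappa>\<in>?K. Q \<kappa>}) = (\<Sum>\<kappa>\<in>?K. of_bool (Q \<kappa>) :: rat)" for Q
  proof -
    have "{\<kappa>\<in>?K. Q \<kappa>} = ?K \<inter> {\<kappa>. Q \<kappa>}" by blast
    then show ?thesis using finK by simp
  qed
  have restr: "edge_colourings R (G\<lparr>edges := S\<rparr>) m = {\<kappa>\<in>?K. \<forall>e\<in>S. ?P \<kappa> e}" for S
    by (auto simp: edge_colourings_def colouring_monomial_def)
  have "(\<Sum>S\<in>Pow ?E. (- 1) ^ card S * colour_series R (G\<lparr>edges := S\<rparr>) m) =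
    (\<Sum>S\<in>Pow ?E. (- 1) ^ card S * of_nat (card {\<kappa>\<in>?K. \<forall>e\<in>S. ?P \<kappa> e}))"
    by (simp only: colour_series_def restr)
  also have "\<dots> = (\<Sum>S\<in>Pow ?E. (- 1) ^ card S * (\<Sum>\<kappa>\<in>?K. of_bool (\<forall>e\<in>S. ?P \<kappa> e)))"
    by (simp only: card_eq)
  also have "\<dots> = (\<Sum>\<kappa>\<in>?K. \<Sum>S\<in>Pow ?E. (- 1) ^ card S * of_bool (\<forall>e\<in>S. ?P \<kappa> e))"
    unfolding sum_distrib_left by (rule sum.swap)
  \<comment> \<open>The trivial product over \<open>?E - S\<close> gives the terms the shape of the
    expansion in \<open>prod_diff_conv_sum\<close>.\<close>
  also have "\<dots> = (\<Sum>\<kappa>\<in>?K. \<Sum>S\<in>Pow ?E. (- 1) ^ card S * (\<Prod>e\<in>S. of_bool (?P \<kappa> e)) * (\<Prod>e\<in>?E - S. 1))"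
  proof (intro sum.cong refl)
    fix \<kappa> S assume "S \<in> Pow ?E"
    then have "finite S" using finE finite_subset by auto
    then have "(\<Prod>e\<in>S. of_bool (?P \<kappa> e)) = (of_bool (\<forall>e\<in>S. ?P \<kappa> e) :: rat)"
      by (induction S rule: finite_induct) auto
    then show "(- 1) ^ card S * of_bool (\<forall>e\<in>S. ?P \<kappa> e) =
        (- 1) ^ card S * (\<Prod>e\<in>S. of_bool (?P \<kappa> e)) * (\<Prod>e\<in>?E - S. 1 :: rat)"
      by simp
  qed
  also have "\<dots> = (\<Sum>\<kappa>\<in>?K. \<Prod>e\<in>?E. 1 - of_bool (?P \<kappa> e))"
    using finE by (simp only: prod_diff_conv_sum)
  also have "\<dots> = (\<Sum>\<kappa>\<in>?K. of_bool (\<forall>e\<in>?E. \<not> ?P \<kappa> e))"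
  proof (intro sum.cong refl)
    fix \<kappa>
    show "(\<Prod>e\<in>?E. 1 - of_bool (?P \<kappa> e)) = (of_bool (\<forall>e\<in>?E. \<not> ?P \<kappa> e) :: rat)"
      using finE by (induction rule: finite_induct) auto
  qed
  also have "\<dots> = of_nat (card {\<kappa>\<in>?K. \<forall>e\<in>?E. \<not> ?P \<kappa> e})"
    by (simp only: card_eq)
  also have "{\<kappa>\<in>?K. \<forall>e\<in>?E. \<not> ?P \<kappa> e} = edge_colourings (\<lambda>a b. \<not> R a b) G m"
    using neg by (auto simp: edge_colourings_def)
  finally show ?thesis by (simp add: colour_series_def)
qed

text \<open>Equality along edges propagates along paths, so a colouring counted here has a single
  colour \<open>j\<close>, and its monomial is a power of one variable with the total weight as
  exponent. The coefficient of the power sum counts exactly these \<open>j\<close>.\<close>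

lemma colour_series_connected:
  assumes "connected_wgraph G" "simple_wgraph G"
  shows "colour_series (=) G = coeff (power_sum (total_weight G))"
proof
  fix m
  let ?V = "verts G"
  have E: "edges G \<subseteq> {{u, v} |u v. u \<in> ?V \<and> v \<in> ?V \<and> u \<noteq> v}"
    using assms by (auto simp: simple_wgraph_def)
  obtain r where r: "r \<in> ?V" using assms by (auto simp: connected_wgraph_def)
  have mon: "colouring_monomial G \<kappa> = Poly_Mapping.single j (total_weight G)"
    if "\<And>v. v \<in> ?V \<Longrightarrow> \<kappa> v = j" for \<kappa> j
  proof -
    have "(\<Sum>v\<in>A. Poly_Mapping.single j (weight G v)) = Poly_Mapping.single j (\<Sum>v\<in>A. weight G v)" for A
      by (induction A rule: infinite_finite_induct) (auto simp: single_add)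
    then show ?thesis
      using that by (simp add: colouring_monomial_def total_weight_def)
  qed
  have const: "\<kappa> v = \<kappa> r" if \<kappa>: "\<kappa> \<in> edge_colourings (=) G m" and v: "v \<in> ?V" for \<kappa> v
  proof -
    have "(r, v) \<in> (adjacency G)\<^sup>*"
      using assms r v by (auto simp: connected_wgraph_def)
    then show ?thesis
    proof (induction rule: rtrancl_induct)
      case (step y z)
      have "{y, z} \<in> edges G" using step by (auto simp: adjacency_def)
      moreover from this have "y \<in> ?V" "z \<in> ?V" using E by (auto simp: doubleton_eq_iff)
      ultimately show ?case using \<kappa> step by (auto simp: edge_colourings_def)
    qed simp
  qed
  have "bij_betw (\<lambda>j. restrict (\<lambda>_. j) ?V) {j. Poly_Mapping.single j (total_weight G) = m}
      (edge_colourings (=) G m)"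
  proof (rule bij_betw_byWitness[where f' = "\<lambda>\<kappa>. \<kappa> r"])
    show "(\<lambda>j. restrict (\<lambda>_. j) ?V) ` {j. Poly_Mapping.single j (total_weight G) = m}
        \<subseteq> edge_colourings (=) G m"
      using mon[of "restrict (\<lambda>_. _) ?V"] by (auto simp: edge_colourings_def)
    show "(\<lambda>\<kappa>. \<kappa> r) ` edge_colourings (=) G m \<subseteq> {j. Poly_Mapping.single j (total_weight G) = m}"
    proof clarify
      fix \<kappa> assume \<kappa>: "\<kappa> \<in> edge_colourings (=) G m"
      then show "Poly_Mapping.single (\<kappa> r) (total_weight G) = m"
        using mon[of \<kappa> "\<kappa> r"] const[OF \<kappa>] by (simp add: edge_colourings_def)
    qed
    show "\<forall>\<kappa>\<in>edge_colourings (=) G m. restrict (\<lambda>_. \<kappa> r) ?V = \<kappa>"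
    proof
      fix \<kappa> assume \<kappa>: "\<kappa> \<in> edge_colourings (=) G m"
      then have "\<kappa> \<in> extensional ?V" by (auto simp: edge_colourings_def PiE_def)
      then show "restrict (\<lambda>_. \<kappa> r) ?V = \<kappa>"
        by (auto intro!: extensionalityI[of _ ?V] simp: const[OF \<kappa>])
    qed
  qed (use r in auto)
  then show "colour_series (=) G m = coeff (power_sum (total_weight G)) m"
    by (simp add: colour_series_def power_sum.rep_eq bij_betw_same_card)
qed

section \<open>The basis of power sums\<close>

text \<open>The nonzero exponents with multiplicity, that is, the partition labelling the monomial
  symmetric function to which \<open>m\<close> belongs.\<close>

definition mon_type :: "mon \<Rightarrow> nat multiset" where
  "mon_type m = image_mset (Poly_Mapping.lookup m) (mset_set (Poly_Mapping.keys m))"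

lemma size_mon_type: "size (mon_type m) = card (Poly_Mapping.keys m)"
  by (simp add: mon_type_def)

lemma zero_notin_mon_type: "0 \<notin># mon_type m"
  by (auto simp: mon_type_def in_keys_iff)

lemma keys_single_add:
  "Poly_Mapping.keys (Poly_Mapping.single j k + b) =
    (if k = 0 then Poly_Mapping.keys b else insert j (Poly_Mapping.keys b))" for b :: mon
  by (auto simp: in_keys_iff Poly_Mapping.lookup_add lookup_single when_def split: if_splits)

lemma mon_type_single_add:
  assumes "j \<notin> Poly_Mapping.keys b" "k \<ge> 1"
  shows "mon_type (Poly_Mapping.single j k + b) = add_mset k (mon_type b)"
proof -
  have "image_mset (Poly_Mapping.lookup (Poly_Mapping.single j k + b)) (mset_set (Poly_Mapping.keys b))
      = mon_type b"
    unfolding mon_type_def using assms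
    by (intro image_mset_cong) (auto simp: Poly_Mapping.lookup_add lookup_single when_def)
  then show ?thesis
    using assms by (simp add: mon_type_def[of "Poly_Mapping.single j k + b"] keys_single_add
        Poly_Mapping.lookup_add in_keys_iff)
qed

lemma ex_mon_type:
  assumes "0 \<notin># M"
  shows "\<exists>m. mon_type m = M"
  using assms
proof (induction M)
  case empty
  show ?case by (rule exI[of _ 0]) (simp add: mon_type_def)
next
  case (add k M)
  then obtain m where m: "mon_type m = M" by auto
  obtain j where j: "j \<notin> Poly_Mapping.keys m"
    using ex_new_if_finite[OF infinite_UNIV_nat finite_keys] by blast
  have "mon_type (Poly_Mapping.single j k + m) = add_mset k M"
    using add.prems m by (subst mon_type_single_add[OF j]) auto
  then show ?case ..
qed

text \<open>Monomials with the same exponents differ by a permutation of the variables, and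
  \<open>f\<close> is symmetric.\<close>

lemma coeff_eq_if_mon_type_eq:
  assumes "mon_type m = mon_type m'"
  shows "coeff f m = coeff f m'"
proof -
  let ?U = "Poly_Mapping.keys m \<union> Poly_Mapping.keys m'"
  \<comment> \<open>Both monomials are regarded as functions on the common finite set
    \<open>?U\<close>. Absent variables only add zeros, equally many for both, so equal types give
    equal multisets over \<open>?U\<close> and hence a permutation of it.\<close>
  have *: "image_mset (Poly_Mapping.lookup n) (mset_set ?U) =
      mon_type n + replicate_mset (card ?U - size (mon_type n)) 0"
    if n: "Poly_Mapping.keys n \<subseteq> ?U" for n
  proof -
    let ?W = "?U - Poly_Mapping.keys n"
    have "?U = Poly_Mapping.keys n \<union> ?W" using n by blast
    then have "mset_set ?U = mset_set (Poly_Mapping.keys n) + mset_set ?W"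
      by (metis Diff_disjoint finite_Diff finite_Un finite_keys mset_set_Union)
    moreover have "image_mset (Poly_Mapping.lookup n) (mset_set ?W) = image_mset (\<lambda>_. 0) (mset_set ?W)"
      by (intro image_mset_cong) (auto simp: in_keys_iff)
    moreover have "card ?W = card ?U - size (mon_type n)"
      using n by (simp add: size_mon_type card_Diff_subset)
    ultimately show ?thesis
      by (simp add: mon_type_def image_mset_const_eq)
  qed
  have "image_mset (Poly_Mapping.lookup m) (mset_set ?U) = image_mset (Poly_Mapping.lookup m') (mset_set ?U)"
    using assms by (simp add: *)
  then obtain p where p: "p permutes ?U"
    and eq: "\<forall>x\<in>?U. Poly_Mapping.lookup m x = Poly_Mapping.lookup m' (p x)"
    by (rule image_mset_eq_implies_permutes[rotated]) auto
  have "Poly_Mapping.map_key p m' = m"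
  proof (rule poly_mapping_eqI)
    fix x
    have "Poly_Mapping.lookup m x = Poly_Mapping.lookup m' (p x)"
    proof (cases "x \<in> ?U")
      case False
      then show ?thesis using p by (simp add: permutes_not_in in_keys_iff)
    qed (use eq in blast)
    then show "Poly_Mapping.lookup (Poly_Mapping.map_key p m') x = Poly_Mapping.lookup m x"
      by (simp add: map_key.rep_eq permutes_inj[OF p])
  qed
  moreover have "symmetric_series (coeff f)" using coeff[of f] by simp
  ultimately show ?thesis
    using permutes_bij[OF p] unfolding symmetric_series_def by metis
qed

section \<open>Coefficients of products of power sums\<close>

lemma coeff_sum: "coeff (\<Sum>x\<in>A. h x) m = (\<Sum>x\<in>A. coeff (h x) m)"
  by (induction A rule: infinite_finite_induct) (auto simp: zero_symfun.rep_eq plus_symfun.rep_eq)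

lemma coeff_diff: "coeff (f - g) m = coeff f m - coeff g m"
  unfolding minus_symfun_def plus_symfun.rep_eq uminus_symfun.rep_eq by simp

text \<open>Since \<open>k \<ge> 1\<close>, distinct variables have distinct \<open>k\<close>-th
  powers, so each coefficient counts at most one \<open>j\<close>.\<close>

lemma coeff_power_sum:
  assumes "k \<ge> 1"
  shows "coeff (power_sum k) m = (if \<exists>j. m = Poly_Mapping.single j k then 1 else 0)"
proof -
  have inj: "Poly_Mapping.single i k = Poly_Mapping.single j k \<longleftrightarrow> i = j" for i j
    using assms by (metis lookup_single_eq lookup_single_not_eq not_one_le_zero)
  show ?thesis
  proof (cases "\<exists>j. m = Poly_Mapping.single j k")
    case True
    then obtain j where j: "m = Poly_Mapping.single j k" by blast
    have "{i. Poly_Mapping.single i k = m} = {j}"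
      by (simp only: j inj) simp
    then show ?thesis using True by (simp only: power_sum.rep_eq) simp
  next
    case False
    then have "{i. Poly_Mapping.single i k = m} = {}" by blast
    then show ?thesis by (simp only: power_sum.rep_eq False) simp
  qed
qed

lemma coeff_power_sum_part_Cons:
  "coeff (power_sum_part (k # l)) m =
    (\<Sum>(a, b)\<in>{(a, b). a + b = m}. coeff (power_sum k) a * coeff (power_sum_part l) b)"
  by (simp add: power_sum_part_def times_symfun.rep_eq series_mult_def)

lemma coeff_power_sum_part_nonneg: "coeff (power_sum_part l) m \<ge> 0"
proof (induction l arbitrary: m)
  case Nil
  show ?case by (simp add: power_sum_part_def one_symfun.rep_eq)
next
  case (Cons k l)
  then show ?case
    unfolding coeff_power_sum_part_Cons
    by (intro sum_nonneg) (simp add: power_sum.rep_eq case_prod_unfold)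
qed

text \<open>A monomial of \<open>p_l\<close> arises by merging parts of \<open>l\<close>, so it has fewer variables than \<open>l\<close>
  has parts unless its exponents are exactly the parts.\<close>

lemma coeff_power_sum_part_nonzero:
  assumes "\<forall>k\<in>set l. k \<ge> 1" "coeff (power_sum_part l) m \<noteq> 0"
  shows "mdeg m = sum_list l" "card (Poly_Mapping.keys m) \<le> length l"
    "card (Poly_Mapping.keys m) = length l \<Longrightarrow> mon_type m = mset l"
proof -
  have "mdeg m = sum_list l \<and> card (Poly_Mapping.keys m) \<le> length l \<and>
      (card (Poly_Mapping.keys m) = length l \<longrightarrow> mon_type m = mset l)"
    using assms
  proof (induction l arbitrary: m)
    case Nil
    then have "m = 0" by (auto simp: power_sum_part_def one_symfun.rep_eq split: if_splits)
    then show ?case by (simp add: mon_type_def)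
  next
    case (Cons k l)
    obtain p where "p \<in> {(a, b). a + b = m}"
      "(case p of (a, b) \<Rightarrow> coeff (power_sum k) a * coeff (power_sum_part l) b) \<noteq> 0"
      using Cons.prems(2) unfolding coeff_power_sum_part_Cons
      by (rule sum.not_neutral_contains_not_neutral)
    then obtain a b where ab: "a + b = m" "coeff (power_sum k) a \<noteq> 0" "coeff (power_sum_part l) b \<noteq> 0"
      by (cases p) auto
    from ab(2) obtain j where "a = Poly_Mapping.single j k"
      using Cons.prems(1) by (auto simp: coeff_power_sum split: if_splits)
    then have m: "m = Poly_Mapping.single j k + b" using ab(1) by simp
    have k: "k \<ge> 1" and IH: "mdeg b = sum_list l" "card (Poly_Mapping.keys b) \<le> length l"
      "card (Poly_Mapping.keys b) = length l \<longrightarrow> mon_type b = mset l"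
      using Cons.IH[OF _ ab(3)] Cons.prems(1) by auto
    show ?case
    \<comment> \<open>If variable \<open>j\<close> already occurs in \<open>b\<close>, then
      \<open>m\<close> has at most \<open>length l\<close> variables, fewer than
      \<open>k # l\<close> has parts, and the claim on types is vacuous. Otherwise one variable and
      one part are added.\<close>
    proof (cases "j \<in> Poly_Mapping.keys b")
      case True
      then show ?thesis using k IH by (simp add: m keys_single_add insert_absorb mdeg_add)
    next
      case False
      then show ?thesis using k IH
        by (simp add: m keys_single_add mdeg_add mon_type_single_add)
    qed
  qed
  then show "mdeg m = sum_list l" "card (Poly_Mapping.keys m) \<le> length l"
    "card (Poly_Mapping.keys m) = length l \<Longrightarrow> mon_type m = mset l"
    by blast+
qed

text \<open>Splitting off a variable with exponent \<open>k\<close> contributes a positive product,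
  and by \<open>coeff_power_sum_part_nonneg\<close> nothing can cancel it.\<close>

lemma coeff_power_sum_part_pos:
  assumes "mon_type m = mset l"
  shows "coeff (power_sum_part l) m > 0"
  using assms
proof (induction l arbitrary: m)
  case Nil
  then have "m = 0" by (simp add: mon_type_def mset_set_empty_iff)
  then show ?case by (simp add: power_sum_part_def one_symfun.rep_eq)
next
  case (Cons k l)
  then have "k \<in># mon_type m" by simp
  then obtain j where j: "j \<in> Poly_Mapping.keys m" "Poly_Mapping.lookup m j = k"
    by (auto simp: mon_type_def)
  then have k: "k \<ge> 1" by (auto simp: in_keys_iff)
  let ?a = "Poly_Mapping.single j k" and ?b = "Poly_Mapping.update j 0 m"
  have m: "?a + ?b = m"
    by (rule poly_mapping_eqI)
      (auto simp: Poly_Mapping.lookup_add lookup_single when_def j(2) update.rep_eq)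
  have nb: "j \<notin> Poly_Mapping.keys ?b"
    by (simp add: in_keys_iff update.rep_eq)
  have "add_mset k (mon_type ?b) = add_mset k (mset l)"
    using mon_type_single_add[OF nb k] Cons.prems by (simp add: m)
  then have "coeff (power_sum_part l) ?b > 0"
    by (intro Cons.IH) simp
  moreover have "coeff (power_sum k) ?a = 1"
    using k by (auto simp: coeff_power_sum)
  ultimately have "0 < (case (?a, ?b) of (a, b) \<Rightarrow> coeff (power_sum k) a * coeff (power_sum_part l) b)"
    by simp
  then show ?case
    unfolding coeff_power_sum_part_Cons
    by (intro sum_pos2[where i = "(?a, ?b)"])
      (auto simp: m finite_mon_splits power_sum.rep_eq coeff_power_sum_part_nonneg)
qed

section \<open>Partitions and linear independence of the \<open>p_l\<close>\<close>

lemma is_partition_pos: "is_partition l \<Longrightarrow> \<forall>k\<in>set l. k \<ge> 1"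
  by (simp add: is_partition_def)

lemma partition_eq_if_mset_eq:
  assumes "is_partition l" "is_partition l'" "mset l = mset l'"
  shows "l = l'"
proof -
  have "sorted (rev l)" "sorted (rev l')"
    using assms by (auto simp: is_partition_def sorted_wrt_rev)
  then have "rev l = rev l'"
    using assms(3) by (metis mset_rev properties_for_sort)
  then show ?thesis by simp
qed

lemma ex_partition_mset:
  assumes "0 \<notin># M"
  shows "\<exists>l. is_partition l \<and> mset l = M"
proof (intro exI conjI)
  let ?l = "rev (sorted_list_of_multiset M)"
  show "is_partition ?l"
    using assms by (auto simp: is_partition_def sorted_wrt_rev Suc_le_eq intro!: Nat.gr0I)
  show "mset ?l = M" by simp
qed

text \<open>The length of \<open>l\<close> is the largest number of variables in a monomial of
  \<open>p_l\<close>, attained only in type \<open>l\<close>, so \<open>p_l\<close> determines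
  \<open>l\<close>. This makes it legitimate to prescribe a linear map on the set of the
  \<open>p_l\<close> by a rule in \<open>l\<close>.\<close>

lemma inj_on_power_sum_part: "inj_on power_sum_part {l. is_partition l}"
proof (rule inj_onI, clarify)
  fix l l' assume l: "is_partition l" and l': "is_partition l'" and eq: "power_sum_part l = power_sum_part l'"
  have *: "length l \<le> length l' \<and> (length l = length l' \<longrightarrow> mset l = mset l')"
    if l: "is_partition l" and l': "is_partition l'" and eq: "power_sum_part l = power_sum_part l'" for l l'
  proof -
    obtain m where m: "mon_type m = mset l"
      using ex_mon_type[of "mset l"] is_partition_pos[OF l] by fastforce
    then have "coeff (power_sum_part l') m \<noteq> 0"
      using coeff_power_sum_part_pos[OF m] eq by simp
    note nz = coeff_power_sum_part_nonzero[OF is_partition_pos[OF l'] this]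
    have "card (Poly_Mapping.keys m) = length l"
      using m by (simp flip: size_mon_type)
    then show ?thesis using nz m by auto
  qed
  have "mset l = mset l'"
    using *[OF l l' eq] *[OF l' l eq[symmetric]] by simp
  then show "l = l'"
    using partition_eq_if_mset_eq l l' by blast
qed

text \<open>Triangularity by number of parts: in a vanishing combination, pick \<open>w\<close> with
  the most parts among the terms of nonzero coefficient. A monomial with the parts of
  \<open>w\<close> as exponents occurs in no other such term, so the coefficient of \<open>w\<close>
  would vanish.\<close>

lemma independent_power_sum_part: "symfun.independent (power_sum_part ` {l. is_partition l})"
  unfolding symfun.dependent_explicit
proof (clarify)
  fix t u v
  assume t: "finite t" "t \<subseteq> power_sum_part ` {l. is_partition l}"
    and zero: "(\<Sum>v\<in>t. symfun_scale (u v) v) = 0" and v: "v \<in> t" "u v \<noteq> 0"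
  define part where "part = inv_into {l. is_partition l} power_sum_part"
  have part: "is_partition (part w)" "power_sum_part (part w) = w" if "w \<in> t" for w
    using that t(2) inv_into_into[of w power_sum_part "{l. is_partition l}"]
    by (auto simp: part_def f_inv_into_f subsetD)
  let ?t = "{w \<in> t. u w \<noteq> 0}"
  let ?L = "\<lambda>w. length (part w)"
  have "finite (?L ` ?t)" "?L ` ?t \<noteq> {}" using t v by auto
  from Max_in[OF this] obtain w where w: "w \<in> t" "u w \<noteq> 0" "?L w = Max (?L ` ?t)" by auto
  have max: "?L x \<le> ?L w" if "x \<in> t" "u x \<noteq> 0" for x
    unfolding w(3) using that t(1) by (intro Max_ge) auto
  obtain m where m: "mon_type m = mset (part w)"
    using ex_mon_type[of "mset (part w)"] is_partition_pos[OF part(1)[OF w(1)]] by fastforce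
  then have card: "card (Poly_Mapping.keys m) = ?L w"
    by (simp flip: size_mon_type)
  \<comment> \<open>If \<open>m\<close> occurs in \<open>x\<close>, then \<open>x\<close> has at
    least as many parts as \<open>w\<close>; maximality forces equality, and then the type of
    \<open>m\<close> identifies the partition.\<close>
  have others: "u x * coeff x m = 0" if x: "x \<in> t" "x \<noteq> w" for x
  proof (rule ccontr)
    assume nz: "u x * coeff x m \<noteq> 0"
    then have "coeff (power_sum_part (part x)) m \<noteq> 0" using part x by simp
    note c = coeff_power_sum_part_nonzero[OF is_partition_pos[OF part(1)[OF x(1)]] this]
    have "?L x = ?L w" using c(2) max[OF x(1)] nz card by simp
    then have "mset (part x) = mset (part w)" using c(3) card m by simp
    then have "part x = part w"
      using partition_eq_if_mset_eq part(1) x w by blast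
    then show False using part(2) x w by metis
  qed
  have "(\<Sum>x\<in>t - {w}. u x * coeff x m) = 0"
    by (intro sum.neutral ballI others) auto
  then have "(\<Sum>x\<in>t. u x * coeff x m) = u w * coeff w m"
    using t(1) w(1) by (simp add: sum.remove[of _ w])
  moreover have "(\<Sum>x\<in>t. u x * coeff x m) = 0"
    using arg_cong[OF zero, of "\<lambda>f. coeff f m"]
    by (simp add: coeff_sum symfun_scale.rep_eq zero_symfun.rep_eq)
  moreover have "coeff w m > 0"
    using coeff_power_sum_part_pos[OF m] part(2)[OF w(1)] by simp
  ultimately show False using w(2) by simp
qed

section \<open>The \<open>p_l\<close> span, degree by degree\<close>

lemma finite_partitions:
  assumes "finite D"
  shows "finite {l. is_partition l \<and> length l = L \<and> sum_list l \<in> D}"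
proof (rule finite_subset)
  show "{l. is_partition l \<and> length l = L \<and> sum_list l \<in> D} \<subseteq>
      {l. set l \<subseteq> {..Max D} \<and> length l = L}"
  proof (rule subsetI)
    fix l assume l: "l \<in> {l. is_partition l \<and> length l = L \<and> sum_list l \<in> D}"
    have "k \<le> Max D" if "k \<in> set l" for k
      using member_le_sum_list[of k l] Max_ge[OF assms, of "sum_list l"] that l by simp
    then show "l \<in> {l. set l \<subseteq> {..Max D} \<and> length l = L}"
      using l by auto
  qed
  show "finite {l :: nat list. set l \<subseteq> {..Max D} \<and> length l = L}"
    by (rule finite_lists_length_eq) simp
qed

lemma sum_mset_mon_type: "sum_mset (mon_type m) = mdeg m"
  by (simp add: mon_type_def mdeg_def sum_unfold_sum_mset)

text \<open>Induction on a bound for the number of variables: a combination \<open>g\<close> of the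
  \<open>p_l\<close> with \<open>L\<close> parts matches \<open>f\<close> on the monomials in
  exactly \<open>L\<close> variables, so \<open>f - g\<close> involves fewer. The set
  \<open>D\<close> of degrees covers both all degrees up to a bound and a single degree, as the
  grading requires.\<close>

lemma in_span_power_sum_part_if_few_variables:
  assumes "finite D"
    and "\<And>m. coeff f m \<noteq> 0 \<Longrightarrow> mdeg m \<in> D \<and> card (Poly_Mapping.keys m) < L"
  shows "f \<in> symfun.span (power_sum_part ` {l. is_partition l \<and> sum_list l \<in> D})"
  using assms(2)
proof (induction L arbitrary: f)
  case 0
  then have "f = 0" by (auto simp: coeff_inject[symmetric] zero_symfun.rep_eq fun_eq_iff)
  then show ?case by (simp add: symfun.span_zero)
next
  case (Suc L)
  let ?P = "{l. is_partition l \<and> length l = L \<and> sum_list l \<in> D}"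
  let ?S = "symfun.span (power_sum_part ` {l. is_partition l \<and> sum_list l \<in> D})"
  \<comment> \<open>One monomial per type suffices, since \<open>f\<close> and the
    \<open>p_l\<close> are symmetric; \<open>c l\<close> makes the multiple of \<open>p_l\<close>
    agree with \<open>f\<close> there, the divisor being positive by
    \<open>coeff_power_sum_part_pos\<close>.\<close>
  define rep where "rep = (\<lambda>l :: nat list. SOME m. mon_type m = mset l)"
  define c where "c = (\<lambda>l. coeff f (rep l) / coeff (power_sum_part l) (rep l))"
  define g where "g = (\<Sum>l\<in>?P. symfun_scale (c l) (power_sum_part l))"
  have rep: "mon_type (rep l) = mset l" if "is_partition l" for l
  proof -
    have "\<exists>m. mon_type m = mset l"
      using ex_mon_type[of "mset l"] is_partition_pos[OF that] by fastforce
    then show ?thesis unfolding rep_def by (rule someI_ex)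
  qed
  have coeff_g: "coeff g m = (\<Sum>l\<in>?P. c l * coeff (power_sum_part l) m)" for m
    by (simp add: g_def coeff_sum symfun_scale.rep_eq)
  have g_zero: "coeff g m = 0" if "mdeg m \<notin> D \<or> card (Poly_Mapping.keys m) > L" for m
    unfolding coeff_g
  proof (intro sum.neutral ballI)
    fix l assume l: "l \<in> ?P"
    then have "coeff (power_sum_part l) m = 0"
      using coeff_power_sum_part_nonzero(1,2)[of l m] that is_partition_pos[of l] by fastforce
    then show "c l * coeff (power_sum_part l) m = 0" by simp
  qed
  have g_top: "coeff g m = coeff f m" if D: "mdeg m \<in> D" and L: "card (Poly_Mapping.keys m) = L" for m
  proof -
    obtain l where l: "is_partition l" "mset l = mon_type m"
      using ex_partition_mset[OF zero_notin_mon_type] by blast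
    have "length l = L" "sum_list l = mdeg m"
      using arg_cong[OF l(2), of size] arg_cong[OF l(2), of sum_mset] L
      by (simp_all add: size_mon_type sum_mset_mon_type sum_mset_sum_list)
    then have lP: "l \<in> ?P" using l D by simp
    \<comment> \<open>With exactly \<open>L\<close> parts, \<open>p_l'\<close> contains a monomial
      in \<open>L\<close> variables only if \<open>l'\<close> is its type, so a single summand of
      \<open>g\<close> survives at \<open>m\<close>.\<close>
    have others: "c l' * coeff (power_sum_part l') m = 0" if l': "l' \<in> ?P" "l' \<noteq> l" for l'
    proof (rule ccontr)
      assume "c l' * coeff (power_sum_part l') m \<noteq> 0"
      then have "mset l' = mset l"
        using coeff_power_sum_part_nonzero(3)[of l' m] is_partition_pos[of l'] l' L l by simp
      then show False using partition_eq_if_mset_eq l l' by blast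
    qed
    have "(\<Sum>l'\<in>?P - {l}. c l' * coeff (power_sum_part l') m) = 0"
      by (intro sum.neutral ballI others) auto
    then have "coeff g m = c l * coeff (power_sum_part l) m"
      unfolding coeff_g by (simp only: sum.remove[OF finite_partitions[OF assms(1)] lP] add_0_right)
    moreover have "coeff h (rep l) = coeff h m" for h
      using l rep by (intro coeff_eq_if_mon_type_eq) simp
    moreover have "coeff (power_sum_part l) m > 0"
      using l by (intro coeff_power_sum_part_pos) simp
    ultimately show ?thesis by (simp add: c_def)
  qed
  have "f - g \<in> ?S"
  proof (rule Suc.IH)
    fix m assume nz: "coeff (f - g) m \<noteq> 0"
    show "mdeg m \<in> D \<and> card (Poly_Mapping.keys m) < L"
    \<comment> \<open>In the first case \<open>g\<close> vanishes at \<open>m\<close>, so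
      \<open>f\<close> would be nonzero outside its assumed support; otherwise \<open>f\<close> and
      \<open>g\<close> cancel on exactly \<open>L\<close> variables.\<close>
    proof (cases "mdeg m \<notin> D \<or> card (Poly_Mapping.keys m) > L")
      case True
      then have "coeff f m \<noteq> 0" using nz g_zero by (simp add: coeff_diff)
      then show ?thesis using Suc.prems[of m] True by simp
    next
      case False
      then show ?thesis using nz g_top[of m] by (cases "card (Poly_Mapping.keys m) = L") (auto simp: coeff_diff)
    qed
  qed
  moreover have "g \<in> ?S"
    unfolding g_def by (intro symfun.span_sum symfun.span_scale symfun.span_base) auto
  ultimately have "(f - g) + g \<in> ?S" by (rule symfun.span_add)
  then show ?case by simp
qed

lemma card_keys_le_mdeg: "card (Poly_Mapping.keys m) \<le> mdeg m"
  unfolding mdeg_def card_eq_sum by (intro sum_mono) (auto simp: in_keys_iff)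

text \<open>A monomial has no more variables than its degree, so \<open>Suc (Max D)\<close> is a
  strict bound on their number.\<close>

lemma in_span_power_sum_part:
  assumes "finite D" "\<And>m. coeff f m \<noteq> 0 \<Longrightarrow> mdeg m \<in> D"
  shows "f \<in> symfun.span (power_sum_part ` {l. is_partition l \<and> sum_list l \<in> D})"
proof (rule in_span_power_sum_part_if_few_variables[OF assms(1)])
  fix m assume "coeff f m \<noteq> 0"
  then have "mdeg m \<in> D" by (rule assms(2))
  moreover from this have "mdeg m \<le> Max D" using assms(1) by simp
  ultimately show "mdeg m \<in> D \<and> card (Poly_Mapping.keys m) < Suc (Max D)"
    using card_keys_le_mdeg[of m] by simp
qed

text \<open>A symmetric function has bounded degree, so finitely many degrees are enough.\<close>

lemma span_power_sum_part: "symfun.span (power_sum_part ` {l. is_partition l}) = UNIV"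
proof -
  have "f \<in> symfun.span (power_sum_part ` {l. is_partition l})" for f
  proof -
    obtain d where "\<And>m. coeff f m \<noteq> 0 \<Longrightarrow> mdeg m \<le> d"
      using coeff[of f] by (auto simp: bounded_degree_def)
    then have "f \<in> symfun.span (power_sum_part ` {l. is_partition l \<and> sum_list l \<in> {..d}})"
      by (intro in_span_power_sum_part) auto
    then show ?thesis
      by (rule subsetD[OF symfun.span_mono, rotated]) auto
  qed
  then show ?thesis by blast
qed

section \<open>Neat families\<close>

lemma symfun_scale_mult: "symfun_scale c f * g = symfun_scale c (f * g)"
  by transfer (simp add: fun_eq_iff series_mult_def sum_distrib_left case_prod_unfold mult.assoc)

lemma colour_series_family_part_Cons:
  assumes "nifty G" "\<forall>k\<in>set (n # l). k \<ge> 1"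
  shows "colour_series R (family_part G (n # l)) =
    series_mult (colour_series R (G n)) (colour_series R (family_part G l))"
  unfolding family_part_def list.map
proof (rule colour_series_disjoint_union_Cons)
  show "\<forall>H\<in>set (G n # map G l). finite (verts H)"
    "\<forall>H\<in>set (G n # map G l). \<forall>v\<in>verts H. weight H v \<ge> 1"
    using assms by (auto simp: nifty_def simple_wgraph_def)
qed

lemma chromatic_family_part:
  assumes "nifty G" "\<forall>k\<in>set l. k \<ge> 1"
  shows "chromatic (family_part G l) = prod_list (map (\<lambda>n. chromatic (G n)) l)"
  using assms(2)
proof (induction l)
  case Nil
  have "coeff (chromatic (family_part G [])) = coeff 1"
    unfolding coeff_chromatic family_part_def list.map colour_series_disjoint_union_Nil one_symfun.rep_eq ..
  then show ?case by (simp add: coeff_inject)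
next
  case (Cons n l)
  have "coeff (chromatic (family_part G (n # l))) = coeff (chromatic (G n) * chromatic (family_part G l))"
    using assms(1) Cons.prems
    by (simp add: coeff_chromatic times_symfun.rep_eq colour_series_family_part_Cons)
  then show ?case using Cons by (simp add: coeff_inject)
qed

lemma colour_series_eq_family_part:
  assumes "nifty G" "\<forall>k\<in>set l. k \<ge> 1"
  shows "colour_series (=) (family_part G l) = coeff (power_sum_part l)"
  using assms(2)
proof (induction l)
  case Nil
  show ?case
    unfolding family_part_def list.map colour_series_disjoint_union_Nil
    by (simp add: power_sum_part_def one_symfun.rep_eq)
next
  case (Cons n l)
  have "colour_series (=) (G n) = coeff (power_sum n)"
    using assms(1) Cons.prems colour_series_connected[of "G n"] by (simp add: nifty_def)
  then show ?case
    using assms(1) Cons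
    by (simp add: colour_series_family_part_Cons power_sum_part_def times_symfun.rep_eq)
qed

text \<open>Keeping the edges \<open>S\<close> means deleting the others, to which neatness applies.
  The partition found does not depend on \<open>R\<close>, so the same one can appear in both
  expansions below.\<close>

lemma neat_subgraph:
  assumes "neat G" "n \<ge> 1" "S \<subseteq> edges (G n)"
  obtains l where "partition_of l n" "\<And>R. colour_series R ((G n)\<lparr>edges := S\<rparr>) = colour_series R (family_part G l)"
proof -
  have "edges (G n) - S \<subseteq> edges (G n)" by blast
  then obtain l where l: "partition_of l n"
    and iso: "wgraph_iso (delete_edges (G n) (edges (G n) - S)) (family_part G l)"
    using assms(1,2) unfolding neat_def by blast
  have "delete_edges (G n) (edges (G n) - S) = (G n)\<lparr>edges := S\<rparr>"
    using assms(3) by (simp add: delete_edges_def double_diff)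
  then show ?thesis using that l colour_series_iso[OF iso] by metis
qed

text \<open>Inclusion-exclusion expands \<open>X_(G_n)\<close> in the \<open>p_l\<close> and, with the same signs and partitions,
  \<open>p_n\<close> in the \<open>X_(G_l)\<close>.\<close>

lemma neat_expansions:
  fixes G :: "nat \<Rightarrow> 'a wgraph"
  assumes "neat G" "n \<ge> 1"
  obtains I :: "'a set set set" and s :: "'a set set \<Rightarrow> rat" and L :: "'a set set \<Rightarrow> nat list"
  where "\<And>S. S \<in> I \<Longrightarrow> is_partition (L S)"
    "chromatic (G n) = (\<Sum>S\<in>I. symfun_scale (s S) (power_sum_part (L S)))"
    "power_sum n = (\<Sum>S\<in>I. symfun_scale (s S) (chromatic (family_part G (L S))))"
proof -
  have nifty: "nifty G" using assms(1) by (simp add: neat_def)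
  then have G: "simple_wgraph (G n)" "connected_wgraph (G n)" "total_weight (G n) = n"
    using assms(2) by (simp_all add: nifty_def)
  let ?I = "Pow (edges (G n))"
  let ?s = "\<lambda>S :: 'a set set. (- 1) ^ card S :: rat"
  have "\<forall>S\<in>?I. \<exists>l. partition_of l n \<and>
      (\<forall>R. colour_series R ((G n)\<lparr>edges := S\<rparr>) = colour_series R (family_part G l))"
    using neat_subgraph[OF assms] by (metis PowD)
  then obtain L where L: "\<And>S. S \<in> ?I \<Longrightarrow> partition_of (L S) n"
    "\<And>S R. S \<in> ?I \<Longrightarrow> colour_series R ((G n)\<lparr>edges := S\<rparr>) = colour_series R (family_part G (L S))"
    by metis
  have part: "is_partition (L S)" if "S \<in> ?I" for S
    using L(1)[OF that] by (simp add: partition_of_def)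
  have "coeff (chromatic (G n)) m = coeff (\<Sum>S\<in>?I. symfun_scale (?s S) (power_sum_part (L S))) m" for m
  proof -
    have "coeff (chromatic (G n)) m = (\<Sum>S\<in>?I. ?s S * colour_series (=) ((G n)\<lparr>edges := S\<rparr>) m)"
      unfolding coeff_chromatic by (rule colour_series_inclusion_exclusion[OF G(1)]) simp
    also have "\<dots> = (\<Sum>S\<in>?I. ?s S * coeff (power_sum_part (L S)) m)"
      using colour_series_eq_family_part[OF nifty is_partition_pos[OF part]]
      by (intro sum.cong refl) (simp add: L(2))
    finally show ?thesis by (simp add: coeff_sum symfun_scale.rep_eq)
  qed
  moreover have "coeff (power_sum n) m = coeff (\<Sum>S\<in>?I. symfun_scale (?s S) (chromatic (family_part G (L S)))) m" for m
  proof -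
    \<comment> \<open>Equality is written as the negation of \<open>(\<noteq>)\<close> so that
      inclusion-exclusion applies with the two relations exchanged.\<close>
    have "coeff (power_sum n) m = colour_series (\<lambda>a b. \<not> a \<noteq> b) (G n) m"
      using colour_series_connected[OF G(2,1)] G(3) by simp
    also have "\<dots> = (\<Sum>S\<in>?I. ?s S * colour_series (\<noteq>) ((G n)\<lparr>edges := S\<rparr>) m)"
      by (rule colour_series_inclusion_exclusion[OF G(1)]) simp
    also have "\<dots> = (\<Sum>S\<in>?I. ?s S * coeff (chromatic (family_part G (L S))) m)"
      unfolding coeff_chromatic by (intro sum.cong refl) (simp add: L(2))
    finally show ?thesis by (simp add: coeff_sum symfun_scale.rep_eq)
  qed
  ultimately show ?thesis
    using that[of ?I L ?s, OF part] by (simp add: fun_eq_iff flip: coeff_inject)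
qed

text \<open>Each colouring monomial has the total weight as its degree, and the weights of the
  components add up to the sum of the parts.\<close>

lemma homogeneous_chromatic_family_part:
  assumes "nifty G" "is_partition l"
  shows "chromatic (family_part G l) \<in> homogeneous_part (sum_list l)"
proof -
  have "total_weight (family_part G l) = sum_list l"
  proof -
    have "(\<Sum>i<length l. l ! i) = (\<Sum>i<length l. \<Sum>v\<in>verts (G (l ! i)). weight (G (l ! i)) v)"
    proof (rule sum.cong)
      fix i assume "i \<in> {..<length l}"
      then have "l ! i \<ge> 1" using is_partition_pos[OF assms(2)] by simp
      then show "l ! i = (\<Sum>v\<in>verts (G (l ! i)). weight (G (l ! i)) v)"
        using assms(1) by (simp add: nifty_def total_weight_def)
    qed simp
    also have "\<dots> = (\<Sum>(i, v)\<in>(SIGMA i:{..<length l}. verts (G (l ! i))). weight (G (l ! i)) v)"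
      using assms is_partition_pos[OF assms(2)]
      by (intro sum.Sigma) (auto simp: nifty_def simple_wgraph_def)
    also have "\<dots> = total_weight (family_part G l)"
      unfolding total_weight_def family_part_def disjoint_union_def
      by (auto intro!: sum.cong)
    finally show ?thesis by (simp add: sum_list_sum_nth atLeast0LessThan)
  qed
  then have "mdeg m = sum_list l" if "coeff (chromatic (family_part G l)) m \<noteq> 0" for m
    using that card_gt_0_iff[of "edge_colourings (\<noteq>) (family_part G l) m"]
    by (auto simp: coeff_chromatic colour_series_def edge_colourings_def mdeg_colouring_monomial
        dest!: card_ge_0_finite)
  then show ?thesis by (simp add: homogeneous_part_def)
qed

lemma subspace_homogeneous_part: "symfun.subspace (homogeneous_part d)"
  by (rule symfun.subspaceI)
    (auto simp: homogeneous_part_def zero_symfun.rep_eq plus_symfun.rep_eq symfun_scale.rep_eq,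
      metis add.right_neutral)

interpretation symfun_pair: vector_space_pair symfun_scale symfun_scale
  by unfold_locales

lemma linear_eq_if_eq_power_sum_part:
  assumes "Vector_Spaces.linear symfun_scale symfun_scale f"
    "Vector_Spaces.linear symfun_scale symfun_scale g"
    "\<And>l. is_partition l \<Longrightarrow> f (power_sum_part l) = g (power_sum_part l)"
  shows "f = g"
proof
  fix x
  show "f x = g x"
    by (rule symfun_pair.linear_eq_on_span[OF assms(1,2), of "power_sum_part ` {l. is_partition l}"])
      (use assms(3) span_power_sum_part in auto)
qed

theorem theorem6p3:
  fixes G :: "nat \<Rightarrow> 'a wgraph"
  assumes "neat G"
  shows "\<exists>\<phi> :: symfun \<Rightarrow> symfun.
    (Vector_Spaces.linear symfun_scale symfun_scale \<phi> \<and>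
     (\<forall>l. is_partition l \<longrightarrow> \<phi> (power_sum_part l) = chromatic (family_part G l)) \<and>
     (\<forall>\<psi>. Vector_Spaces.linear symfun_scale symfun_scale \<psi> \<and>
        (\<forall>l. is_partition l \<longrightarrow> \<psi> (power_sum_part l) = chromatic (family_part G l)) \<longrightarrow> \<psi> = \<phi>)) \<and>
    (Vector_Spaces.linear symfun_scale symfun_scale \<phi> \<and>
     (\<forall>l. is_partition l \<longrightarrow> \<phi> (chromatic (family_part G l)) = power_sum_part l) \<and>
     (\<forall>\<psi>. Vector_Spaces.linear symfun_scale symfun_scale \<psi> \<and>
        (\<forall>l. is_partition l \<longrightarrow> \<psi> (chromatic (family_part G l)) = power_sum_part l) \<longrightarrow> \<psi> = \<phi>)) \<and>
    (\<forall>f. \<phi> (\<phi> f) = f) \<and>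
    graded_algebra_automorphism \<phi>"
proof -
  let ?P = "{l. is_partition l}"
  let ?lin = "Vector_Spaces.linear symfun_scale symfun_scale"
  have nifty: "nifty G" using assms by (simp add: neat_def)
  obtain \<phi> where lin: "?lin \<phi>"
    and "\<forall>f\<in>power_sum_part ` ?P. \<phi> f = chromatic (family_part G (inv_into ?P power_sum_part f))"
    using symfun_pair.linear_independent_extend[OF independent_power_sum_part,
        of "\<lambda>f. chromatic (family_part G (inv_into ?P power_sum_part f))"] by blast
  then have \<phi>: "\<phi> (power_sum_part l) = chromatic (family_part G l)" if "is_partition l" for l
    using that inv_into_f_f[OF inj_on_power_sum_part] by simp
  interpret \<phi>: Vector_Spaces.linear symfun_scale symfun_scale \<phi> by (rule lin)
  \<comment> \<open>Stated for unsorted lists because the concatenation of two partitions may be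
    unsorted; sorting changes neither product.\<close>
  have \<phi>_prod: "\<phi> (power_sum_part l) = prod_list (map (\<lambda>n. chromatic (G n)) l)"
    if "\<forall>k\<in>set l. k \<ge> 1" for l
  proof -
    have "0 \<notin># mset l" using that by force
    then obtain l' where l': "is_partition l'" "mset l' = mset l"
      using ex_partition_mset by blast
    have perm: "prod_list (map h l') = prod_list (map h l)" for h :: "nat \<Rightarrow> symfun"
      by (metis l'(2) mset_map prod_mset_prod_list)
    have "\<phi> (power_sum_part l) = \<phi> (power_sum_part l')"
      by (simp only: power_sum_part_def perm)
    then show ?thesis
      using \<phi>[OF l'(1)] chromatic_family_part[OF nifty is_partition_pos[OF l'(1)]] by (simp only: perm)
  qed
  have \<phi>_mult: "\<phi> (f * g) = \<phi> f * \<phi> g" for f g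
  proof -
    have basis: "\<phi> (power_sum_part l * power_sum_part l') = \<phi> (power_sum_part l) * \<phi> (power_sum_part l')"
      if "is_partition l" "is_partition l'" for l l'
    proof -
      have "power_sum_part l * power_sum_part l' = power_sum_part (l @ l')"
        by (simp add: power_sum_part_def)
      then show ?thesis
        using \<phi>_prod[of l] \<phi>_prod[of l'] \<phi>_prod[of "l @ l'"] is_partition_pos that by auto
    qed
    \<comment> \<open>Multiplicativity is reduced to the basis in two passes: first in the left
      factor with \<open>p_l\<close> on the right, then, after swapping by commutativity, in the
      other factor with \<open>f\<close> arbitrary.\<close>
    have linear_mult: "?lin (\<lambda>f. \<phi> (f * h))" "?lin (\<lambda>f. \<phi> f * h)" for h
      by (unfold_locales; simp add: distrib_right \<phi>.add \<phi>.scale symfun_scale_mult)+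
    have left: "(\<lambda>f. \<phi> (f * power_sum_part l)) = (\<lambda>f. \<phi> f * \<phi> (power_sum_part l))" if "is_partition l" for l
      by (rule linear_eq_if_eq_power_sum_part[OF linear_mult]) (use basis that in auto)
    have "(\<lambda>g. \<phi> (g * f)) = (\<lambda>g. \<phi> g * \<phi> f)"
      by (rule linear_eq_if_eq_power_sum_part[OF linear_mult])
        (metis (no_types, lifting) left mult.commute)
    then show ?thesis by (metis mult.commute)
  qed
  \<comment> \<open>Applied term by term, \<open>\<phi>\<close> turns the expansion of
    \<open>X_(G_n)\<close> in the \<open>p_l\<close> into that of \<open>p_n\<close> in the
    \<open>X_(G_l)\<close>.\<close>
  have \<phi>_G: "\<phi> (chromatic (G n)) = power_sum n" if n: "n \<ge> 1" for n
  proof -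
    obtain I :: "'a set set set" and s L where "\<And>S. S \<in> I \<Longrightarrow> is_partition (L S)"
      and "chromatic (G n) = (\<Sum>S\<in>I. symfun_scale (s S) (power_sum_part (L S)))"
      and "power_sum n = (\<Sum>S\<in>I. symfun_scale (s S) (chromatic (family_part G (L S))))"
      by (rule neat_expansions[OF assms n]) (rule that)
    then show ?thesis by (simp add: \<phi>.sum \<phi>.scale \<phi>)
  qed
  have \<phi>_one: "\<phi> 1 = 1"
    using \<phi>_prod[of "[]"] by (simp add: power_sum_part_def)
  have \<phi>_chromatic: "\<phi> (chromatic (family_part G l)) = power_sum_part l" if "is_partition l" for l
  proof -
    have "\<phi> (prod_list (map (\<lambda>n. chromatic (G n)) l)) = prod_list (map power_sum l)"
      using is_partition_pos[OF that] by (induction l) (simp_all add: \<phi>_one \<phi>_mult \<phi>_G)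
    then show ?thesis
      using chromatic_family_part[OF nifty is_partition_pos[OF that]] by (simp add: power_sum_part_def)
  qed
  have "\<phi> \<circ> \<phi> = id"
  proof (rule linear_eq_if_eq_power_sum_part)
    show "?lin (\<phi> \<circ> \<phi>)" using lin lin by (rule Vector_Spaces.linear_compose)
    show "?lin id" by (rule symfun.linear_id)
  qed (simp add: \<phi> \<phi>_chromatic)
  then have invol: "\<phi> (\<phi> f) = f" for f by (simp add: fun_eq_iff)
  have bij: "bij \<phi>" using invol by (rule involuntory_imp_bij)
  have unique1: "\<psi> = \<phi>"
    if "?lin \<psi>" "\<forall>l. is_partition l \<longrightarrow> \<psi> (power_sum_part l) = chromatic (family_part G l)" for \<psi>
    using that \<phi> by (intro linear_eq_if_eq_power_sum_part lin) auto
  have unique2: "\<psi> = \<phi>"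
    if "?lin \<psi>" "\<forall>l. is_partition l \<longrightarrow> \<psi> (chromatic (family_part G l)) = power_sum_part l" for \<psi>
  proof -
    \<comment> \<open>\<open>\<psi>\<close> undoes \<open>\<phi>\<close> on every
      \<open>p_l\<close>, hence everywhere; as \<open>\<phi>\<close> is its own inverse, the two
      agree.\<close>
    have "\<psi> \<circ> \<phi> = id"
    proof (rule linear_eq_if_eq_power_sum_part)
      show "?lin (\<psi> \<circ> \<phi>)" using lin that(1) by (rule Vector_Spaces.linear_compose)
      show "?lin id" by (rule symfun.linear_id)
    qed (simp add: \<phi> that(2))
    then have "\<psi> f = \<phi> f" for f by (metis comp_apply id_apply invol)
    then show ?thesis by blast
  qed
  have homogeneous: "\<phi> f \<in> homogeneous_part d" if f: "f \<in> homogeneous_part d" for f d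
  proof -
    \<comment> \<open>Only the \<open>p_l\<close> with parts summing to \<open>d\<close> are needed
      for \<open>f\<close>, and their images \<open>X_(G_l)\<close> are homogeneous of degree
      \<open>d\<close>.\<close>
    have "f \<in> symfun.span (power_sum_part ` {l. is_partition l \<and> sum_list l \<in> {d}})"
      using f by (intro in_span_power_sum_part) (auto simp: homogeneous_part_def)
    then have "\<phi> f \<in> symfun.span (\<phi> ` power_sum_part ` {l. is_partition l \<and> sum_list l \<in> {d}})"
      by (simp add: \<phi>.span_image)
    also have "\<dots> \<subseteq> homogeneous_part d"
      using homogeneous_chromatic_family_part[OF nifty]
      by (intro symfun.span_minimal subspace_homogeneous_part) (auto simp: \<phi>)
    finally show ?thesis .
  qed
  \<comment> \<open>The converse inclusion holds because \<open>f\<close> is the image of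
    \<open>\<phi> f\<close>, which has the same degree.\<close>
  have "\<phi> ` homogeneous_part d = homogeneous_part d" for d
    using homogeneous invol by (metis image_eqI subsetI subset_antisym image_subset_iff)
  then have "graded_algebra_automorphism \<phi>"
    using lin bij \<phi>_one \<phi>_mult by (simp add: graded_algebra_automorphism_def)
  then show ?thesis
    using lin \<phi> \<phi>_chromatic unique1 unique2 invol by (intro exI[of _ \<phi>]) blast
qed

end
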